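(* Let $\ell\ge1$, let $M(1)$ be the Heisenberg vertex operator algebra of rank $\ell$, and let $\bm{\lambda}$ be a Whittaker function. Assume that $\sigma\circ\bm{\lambda}\ne\bm{\lambda}$ for any $2$-cycle $\sigma\in S_{\ell}$. Then the Whittaker module $M(1,\bm{\lambda})$ is an irreducible $M(1)^{S_{\ell}}$-module.
   Context: Let $\mathfrak{h}$ be a complex $\ell$-dimensional vector space with a non-degenerate symmetric bilinear form $(\cdot,\cdot)$, viewed as a commutative Lie algebra, and let $\hat{\mathfrak{h}}=\mathfrak{h}\otimes\mathbb{C}[t,t^{-1}]\oplus\mathbb{C}K$ be the associated Heisenberg Lie algebra: with $a(n)=a\otimes t^n$, $[a(m),b(n)]=m(a,b)\delta_{m+n,0}K$, $K$ central. $M(1)$ is the Heisenberg vertex operator algebra of level $1$ ($K=1$) associated to $\hat{\mathfrak{h}}$. The orthogonal group $O(\ell)=O(\mathfrak{h},(\cdot,\cdot))$ acts on $M(1)$ by automorphisms; the symmetric group $S_\ell\subset O(\ell)$ acts by permuting a fixed orthonormal basis of $\mathfrak{h}$. $M(1)^{S_\ell}$ is the subalgebra of fixed points. Let $\mathfrak{n}=\mathfrak{h}\otimes\mathbb{C}[t]$. A Whittaker function is $\bm{\lambda}\in\mathfrak{n}^*$ such that for each $a\in\mathfrak{h}$, $\bm{\lambda}(a(n))=0$ for $n$ sufficiently large. $M(1,\bm{\lambda})$ is the standard Whittaker $\hat{\mathfrak{h}}$-module of level $1$, i.e. $U(\hat{\mathfrak{h}})\otimes_{U(\mathfrak{n}\oplus\mathbb{C}K)}\mathbb{C}w$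 with $xw=\bm{\lambda}(x)w$ for $x\in\mathfrak{n}$ and $Kw=w$; it is a weak $M(1)$-module. For $g\in O(\ell)$, $(g\circ\bm{\lambda})(a(n))=\bm{\lambda}((g^{-1}a)(n))$. Irreducible as an $M(1)^{S_\ell}$-module means nonzero with no nonzero proper subspace stable under all modes $v_n$, $v\in M(1)^{S_\ell}$. *)

theory Defs
  imports
    Complex_Main
    "HOL.Hull"
    "HOL-Library.Poly_Mapping"
    "HOL-Library.Set_Algebras"
    "HOL-Library.Product_Plus"
    "HOL-Combinatorics.Permutations"
begin

section \<open>The free associative algebra and enveloping algebras\<close>

datatype 'g fword = Fword (letters: "'g list")

instantiation fword :: (type) monoid_add
begin

definition zero_fword :: "'a fword" where
  "0 = Fword []"

definition plus_fword :: "'a fword \<Rightarrow> 'a fword \<Rightarrow> 'a fword" where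
  "u + v = Fword (letters u @ letters v)"

instance
  by standard (simp_all add: zero_fword_def plus_fword_def)

end

text \<open>
  The monoid algebra of the free monoid on \<open>'g\<close>; its product is the convolution product that
  \<open>HOL-Library.Poly_Mapping\<close> puts on finitely supported functions.
\<close>

type_synonym 'g free_alg = "'g fword \<Rightarrow>\<^sub>0 complex"

definition letter :: "'g \<Rightarrow> 'g free_alg" where
  "letter x = Poly_Mapping.single (Fword [x]) 1"

definition scal :: "complex \<Rightarrow> 'g free_alg" where
  "scal c = Poly_Mapping.single 0 c"

definition free_map :: "('g \<Rightarrow> 'k) \<Rightarrow> 'g free_alg \<Rightarrow> 'k free_alg" where
  "free_map h f =
     (\<Sum>w\<in>Poly_Mapping.keys f. Poly_Mapping.single (map_fword h w) (Poly_Mapping.lookup f w))"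

definition left_ideal :: "'r::ring_1 set \<Rightarrow> bool" where
  "left_ideal I \<longleftrightarrow> 0 \<in> I \<and> (\<forall>x\<in>I. \<forall>y\<in>I. x + y \<in> I) \<and> (\<forall>a. \<forall>x\<in>I. a * x \<in> I)"

definition two_sided_ideal :: "'r::ring_1 set \<Rightarrow> bool" where
  "two_sided_ideal I \<longleftrightarrow> left_ideal I \<and> (\<forall>a. \<forall>x\<in>I. x * a \<in> I)"

text \<open>
  The free algebra is taken on the underlying set of the Lie algebra, so the vector space
  structure of the Lie algebra is imposed by relations as well. The enveloping algebra is
  the quotient of \<^typ>\<open>'g free_alg\<close> by this ideal.
\<close>

definition uea_ideal ::
  "(complex \<Rightarrow> 'g::ab_group_add \<Rightarrow> 'g) \<Rightarrow> ('g \<Rightarrow> 'g \<Rightarrow> 'g) \<Rightarrow> 'g free_alg set" where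
  "uea_ideal sc br = two_sided_ideal hull
     ({letter (x + y) - letter x - letter y | x y. True}
      \<union> {letter (sc c x) - scal c * letter x | c x. True}
      \<union> {letter x * letter y - letter y * letter x - letter (br x y) | x y. True})"

text \<open>
  For a subalgebra \<open>B\<close> of a Lie algebra \<open>\<gg>\<close> and a character \<open>\<chi>\<close> of \<open>B\<close>, the induced module
  \<open>U(\<gg>) \<otimes>\<^bsub>U(B)\<^esub> \<complex>w\<close> with \<open>x w = \<chi>(x) w\<close> for \<open>x \<in> B\<close> is \<open>U(\<gg>)\<close> modulo the left ideal generated by
  the elements \<open>x - \<chi>(x)\<close> with \<open>x \<in> B\<close>. It is obtained here directly as the quotient of the free
  algebra by the preimage of that left ideal; the coset of \<open>1\<close> is \<open>1 \<otimes> w\<close>.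
\<close>

definition induced_left_ideal ::
  "(complex \<Rightarrow> 'g::ab_group_add \<Rightarrow> 'g) \<Rightarrow> ('g \<Rightarrow> 'g \<Rightarrow> 'g) \<Rightarrow> 'g set \<Rightarrow> ('g \<Rightarrow> complex)
     \<Rightarrow> 'g free_alg set" where
  "induced_left_ideal sc br B \<chi> =
     left_ideal hull (uea_ideal sc br \<union> {letter x - scal (\<chi> x) | x. x \<in> B})"

section \<open>Quotients by a left ideal\<close>

text \<open>
  Elements of the quotient by \<open>L\<close> are the cosets \<open>f +o L\<close>. The zero element is \<open>L\<close> itself
  (not \<open>0 = {0}\<close>), and the sum of two cosets is the elementwise sum of sets.
\<close>

definition quotient_carrier :: "'r::ring_1 set \<Rightarrow> 'r set set" where
  "quotient_carrier L = {f +o L | f. True}"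

definition quotient_act :: "'r::ring_1 set \<Rightarrow> 'r \<Rightarrow> 'r set \<Rightarrow> 'r set" where
  "quotient_act L u A = u *o A + L"

text \<open>
  Sum of a family of cosets with finitely many nonzero members over a possibly infinite index
  set; the final \<open>+ L\<close> only matters when all members are zero.
\<close>

definition quotient_sum :: "'r::ring_1 set \<Rightarrow> 'i set \<Rightarrow> ('i \<Rightarrow> 'r set) \<Rightarrow> 'r set" where
  "quotient_sum L I X = (\<Sum>i\<in>{i\<in>I. X i \<noteq> L}. X i) + L"

definition quotient_subspace :: "'g free_alg set \<Rightarrow> 'g free_alg set set \<Rightarrow> bool" where
  "quotient_subspace L S \<longleftrightarrow> S \<subseteq> quotient_carrier L \<and> L \<in> S \<and>
     (\<forall>A\<in>S. \<forall>B\<in>S. A + B \<in> S) \<and> (\<forall>c. \<forall>A\<in>S. quotient_act L (scal c) A \<in> S)"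

section \<open>The Heisenberg Lie algebra\<close>

text \<open>\<open>\<hh> \<otimes> \<complex>[t, t\<^sup>-\<^sup>1] \<oplus> \<complex>K\<close>: the pair \<open>(p, c)\<close> stands for \<open>\<Sum>n. p(n) \<otimes> t^n + c K\<close>.\<close>

type_synonym 'h heis = "(int \<Rightarrow>\<^sub>0 'h) \<times> complex"

definition heis_mode :: "'h::zero \<Rightarrow> int \<Rightarrow> 'h heis" where
  "heis_mode a n = (Poly_Mapping.single n a, 0)"

definition heis_scale :: "(complex \<Rightarrow> 'h::zero \<Rightarrow> 'h) \<Rightarrow> complex \<Rightarrow> 'h heis \<Rightarrow> 'h heis" where
  "heis_scale scl c x = (Poly_Mapping.map (scl c) (fst x), c * snd x)"

definition heis_bracket ::
  "('h::zero \<Rightarrow> 'h \<Rightarrow> complex) \<Rightarrow> 'h heis \<Rightarrow> 'h heis \<Rightarrow> 'h heis" where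
  "heis_bracket form x y =
     (0, \<Sum>m\<in>Poly_Mapping.keys (fst x).
            of_int m * form (Poly_Mapping.lookup (fst x) m) (Poly_Mapping.lookup (fst y) (- m)))"

definition heis_nonneg :: "'h::zero heis set" where
  "heis_nonneg = {x. Poly_Mapping.keys (fst x) \<subseteq> {0..}}"

definition heis_neg :: "'h::zero heis set" where
  "heis_neg = {x. Poly_Mapping.keys (fst x) \<subseteq> {..<0} \<and> snd x = 0}"

definition nondegenerate_symmetric_form ::
  "(complex \<Rightarrow> 'h::ab_group_add \<Rightarrow> 'h) \<Rightarrow> ('h \<Rightarrow> 'h \<Rightarrow> complex) \<Rightarrow> bool" where
  "nondegenerate_symmetric_form scl form \<longleftrightarrow>
     (\<forall>a. Vector_Spaces.linear scl (*) (form a)) \<and>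
     (\<forall>a b. form a b = form b a) \<and>
     (\<forall>a. (\<forall>b. form a b = 0) \<longrightarrow> a = 0)"

definition orthonormal_basis ::
  "(complex \<Rightarrow> 'h::ab_group_add \<Rightarrow> 'h) \<Rightarrow> ('h \<Rightarrow> 'h \<Rightarrow> complex) \<Rightarrow> nat \<Rightarrow> (nat \<Rightarrow> 'h) \<Rightarrow> bool" where
  "orthonormal_basis scl form l e \<longleftrightarrow>
     inj_on e {..<l} \<and>
     \<not> module.dependent scl (e ` {..<l}) \<and>
     module.span scl (e ` {..<l}) = UNIV \<and>
     (\<forall>i<l. \<forall>j<l. form (e i) (e j) = (if i = j then 1 else 0))"

section \<open>Whittaker functions and Whittaker modules\<close>

text \<open>A functional on \<open>\<nn> = \<hh> \<otimes> \<complex>[t]\<close> is a function on \<^typ>\<open>nat \<Rightarrow>\<^sub>0 'h\<close>.\<close>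

type_synonym 'h nplus = "nat \<Rightarrow>\<^sub>0 'h"

definition whittaker_function ::
  "(complex \<Rightarrow> 'h::ab_group_add \<Rightarrow> 'h) \<Rightarrow> ('h nplus \<Rightarrow> complex) \<Rightarrow> bool" where
  "whittaker_function scl lam \<longleftrightarrow>
     Vector_Spaces.linear (\<lambda>c. Poly_Mapping.map (scl c)) (*) lam \<and>
     (\<forall>a. \<exists>N. \<forall>n\<ge>N. lam (Poly_Mapping.single n a) = 0)"

text \<open>
  The character \<open>x + c K \<mapsto> \<lambda>(x) + c\<close> of \<open>\<nn> \<oplus> \<complex>K\<close>; it is only used on \<^const>\<open>heis_nonneg\<close>, where
  reindexing along \<open>int :: nat \<Rightarrow> int\<close> forgets nothing.
\<close>

definition whittaker_character :: "('h::zero nplus \<Rightarrow> complex) \<Rightarrow> 'h heis \<Rightarrow> complex" where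
  "whittaker_character lam x = lam (Poly_Mapping.map_key int (fst x)) + snd x"

definition whittaker_ideal ::
  "(complex \<Rightarrow> 'h::ab_group_add \<Rightarrow> 'h) \<Rightarrow> ('h \<Rightarrow> 'h \<Rightarrow> complex) \<Rightarrow> ('h nplus \<Rightarrow> complex)
     \<Rightarrow> 'h heis free_alg set" where
  "whittaker_ideal scl form lam =
     induced_left_ideal (heis_scale scl) (heis_bracket form) heis_nonneg (whittaker_character lam)"

definition whittaker_module ::
  "(complex \<Rightarrow> 'h::ab_group_add \<Rightarrow> 'h) \<Rightarrow> ('h \<Rightarrow> 'h \<Rightarrow> complex) \<Rightarrow> ('h nplus \<Rightarrow> complex)
     \<Rightarrow> 'h heis free_alg set set" where
  "whittaker_module scl form lam = quotient_carrier (whittaker_ideal scl form lam)"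

text \<open>The underlying space of the vertex operator algebra \<open>M(1)\<close> is the Fock space.\<close>

definition heis_voa ::
  "(complex \<Rightarrow> 'h::ab_group_add \<Rightarrow> 'h) \<Rightarrow> ('h \<Rightarrow> 'h \<Rightarrow> complex) \<Rightarrow> 'h heis free_alg set set" where
  "heis_voa scl form = whittaker_module scl form (\<lambda>_. 0)"

section \<open>Vertex operators\<close>

text \<open>
  \<open>Y(v, z) = \<Sum>m. v\<^sub>m z^(-m-1)\<close> on a quotient by \<open>L\<close> is determined by linearity in \<open>v\<close>,
  \<open>Y(1, z) = id\<close> and, for \<open>k \<ge> 1\<close>,
  \<open>Y(a(-k)u, z) = :(\<partial>^(k-1) a(z) / (k-1)!) Y(u, z):\<close> with \<open>a(z) = \<Sum>r. a(r) z^(-r-1)\<close>,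
  so that \<open>Y(a\<^sub>1(-k\<^sub>1) \<dots> a\<^sub>s(-k\<^sub>s)1, z)\<close> is the usual normally ordered product. Since
  \<open>\<partial>^(k-1) a(z) / (k-1)! = \<Sum>r. binomial(-r-1, k-1) a(r) z^(-r-k)\<close>, where the modes with \<open>r < 0\<close> are
  put to the left of \<open>Y(u, z)\<close> and those with \<open>r \<ge> 0\<close> to its right, the coefficient of \<open>z^(-m-1)\<close> is
  \<open>\<Sum>r<0. binomial(-r-1, k-1) a(r) u\<^sub>m\<^sub>-\<^sub>k\<^sub>-\<^sub>r + \<Sum>r\<ge>0. binomial(-r-1, k-1) u\<^sub>m\<^sub>-\<^sub>k\<^sub>-\<^sub>r a(r)\<close>.
  Below \<open>n = -k\<close>, and a letter \<open>x\<close> in \<^const>\<open>heis_neg\<close> is the sum of its components \<open>a(n)\<close>.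
\<close>

primrec word_mode ::
  "'h::zero heis free_alg set \<Rightarrow> 'h heis list \<Rightarrow> int \<Rightarrow> 'h heis free_alg set \<Rightarrow> 'h heis free_alg set"
where
  "word_mode L [] m A = (if m = -1 then A else L)"
| "word_mode L (x # xs) m A =
     quotient_sum L (Poly_Mapping.keys (fst x) \<times> UNIV)
       (\<lambda>(n, r). let a = Poly_Mapping.lookup (fst x) n in
          quotient_act L (scal (of_int (- r - 1) gchoose nat (- n - 1)))
            (if r < 0
             then quotient_act L (letter (heis_mode a r)) (word_mode L xs (m + n - r) A)
             else word_mode L xs (m + n - r) (quotient_act L (letter (heis_mode a r)) A)))"

text \<open>
  \<open>M(1)\<close> is spanned by the classes of the words in negative modes; the operator \<open>v\<^sub>m\<close> does not
  depend on how \<open>v\<close> is written as a combination of such words.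
\<close>

definition negative_representative :: "'h::zero heis free_alg set \<Rightarrow> 'h heis free_alg" where
  "negative_representative v =
     (SOME f. f \<in> v \<and> (\<forall>w\<in>Poly_Mapping.keys f. set (letters w) \<subseteq> heis_neg))"

definition vertex_mode ::
  "'h::zero heis free_alg set \<Rightarrow> 'h heis free_alg set \<Rightarrow> int \<Rightarrow> 'h heis free_alg set
     \<Rightarrow> 'h heis free_alg set" where
  "vertex_mode L v m A =
     (let f = negative_representative v in
        quotient_sum L (Poly_Mapping.keys f)
          (\<lambda>w. quotient_act L (scal (Poly_Mapping.lookup f w)) (word_mode L (letters w) m A)))"

section \<open>The orthogonal and symmetric groups\<close>

definition orthogonal_group ::
  "(complex \<Rightarrow> 'h::ab_group_add \<Rightarrow> 'h) \<Rightarrow> ('h \<Rightarrow> 'h \<Rightarrow> complex) \<Rightarrow> ('h \<Rightarrow> 'h) set" where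
  "orthogonal_group scl form =
     {g. Vector_Spaces.linear scl scl g \<and> bij g \<and> (\<forall>a b. form (g a) (g b) = form a b)}"

definition symmetric_group ::
  "(complex \<Rightarrow> 'h::ab_group_add \<Rightarrow> 'h) \<Rightarrow> ('h \<Rightarrow> 'h \<Rightarrow> complex) \<Rightarrow> nat \<Rightarrow> (nat \<Rightarrow> 'h)
     \<Rightarrow> ('h \<Rightarrow> 'h) set" where
  "symmetric_group scl form l e =
     {g \<in> orthogonal_group scl form. \<exists>p. p permutes {..<l} \<and> (\<forall>i<l. g (e i) = e (p i))}"

definition two_cycles ::
  "(complex \<Rightarrow> 'h::ab_group_add \<Rightarrow> 'h) \<Rightarrow> ('h \<Rightarrow> 'h \<Rightarrow> complex) \<Rightarrow> nat \<Rightarrow> (nat \<Rightarrow> 'h)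
     \<Rightarrow> ('h \<Rightarrow> 'h) set" where
  "two_cycles scl form l e =
     {g \<in> orthogonal_group scl form.
        \<exists>i<l. \<exists>j<l. i \<noteq> j \<and> (\<forall>k<l. g (e k) = e (Transposition.transpose i j k))}"

definition whittaker_act :: "('h::zero \<Rightarrow> 'h) \<Rightarrow> ('h nplus \<Rightarrow> complex) \<Rightarrow> 'h nplus \<Rightarrow> complex" where
  "whittaker_act g lam x = lam (Poly_Mapping.map (inv g) x)"

text \<open>\<open>g (a\<^sub>1(n\<^sub>1) \<dots> a\<^sub>s(n\<^sub>s)1) = (g a\<^sub>1)(n\<^sub>1) \<dots> (g a\<^sub>s)(n\<^sub>s)1\<close>, on cosets.\<close>

definition voa_act ::
  "('h::zero \<Rightarrow> 'h) \<Rightarrow> 'h heis free_alg set \<Rightarrow> 'h heis free_alg set" where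
  "voa_act g v = free_map (\<lambda>x. (Poly_Mapping.map g (fst x), snd x)) ` v"

definition heis_voa_fixed ::
  "(complex \<Rightarrow> 'h::ab_group_add \<Rightarrow> 'h) \<Rightarrow> ('h \<Rightarrow> 'h \<Rightarrow> complex) \<Rightarrow> ('h \<Rightarrow> 'h) set
     \<Rightarrow> 'h heis free_alg set set" where
  "heis_voa_fixed scl form G = {v \<in> heis_voa scl form. \<forall>g\<in>G. voa_act g v = v}"

definition whittaker_irreducible ::
  "(complex \<Rightarrow> 'h::ab_group_add \<Rightarrow> 'h) \<Rightarrow> ('h \<Rightarrow> 'h \<Rightarrow> complex) \<Rightarrow> ('h nplus \<Rightarrow> complex)
     \<Rightarrow> 'h heis free_alg set set \<Rightarrow> bool" where
  "whittaker_irreducible scl form lam V \<longleftrightarrow>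
     (let L = whittaker_ideal scl form lam; W = whittaker_module scl form lam in
        W \<noteq> {L} \<and>
        (\<forall>S. quotient_subspace L S \<and> (\<forall>v\<in>V. \<forall>n. \<forall>A\<in>S. vertex_mode L v n A \<in> S)
              \<longrightarrow> S = {L} \<or> S = W))"

end

theory Submission
  imports Defs "HOL-Library.Product_Lexorder" "HOL-Library.Multiset"
begin

text \<open>
  Realise \<open>M(1,\<lambda>)\<close> as the polynomial ring in variables \<open>e\<^sub>i(-k-1)\<close>, that is, as a tensor product over
  \<open>i < l\<close> of rank one modules: \<open>e\<^sub>i(n)\<close> is a multiplication for \<open>n < 0\<close> and
  \<open>n \<partial>/\<partial>e\<^sub>i(-n) + \<lambda>(e\<^sub>i(n))\<close> for \<open>n \<ge> 0\<close>. That this is the induced module is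
  \<open>whittaker_ideal_eq_kernel\<close>: the Whittaker ideal is the annihilator of the polynomial \<open>1\<close>.

  Among the invariants only the power sums \<open>\<Sum>\<^sub>i e\<^sub>i(-k\<^sub>1-1) \<dots> e\<^sub>i(-k\<^sub>s-1)1\<close> are needed. A mode of such a
  vector is \<open>\<Sum>\<^sub>i\<close> of the sum, over all \<open>r\<^sub>1 + \<dots> + r\<^sub>s = d\<close>, of
  \<open>\<Prod>\<^sub>t binomial(-r\<^sub>t-1, k\<^sub>t) :e\<^sub>i(r\<^sub>1) \<dots> e\<^sub>i(r\<^sub>s):\<close>. The binomials span all polynomials in \<open>r\<close>, and only
  finitely many tuples \<open>r\<close> act nontrivially on a given vector. By interpolation, a subspace that is
  stable under these modes is therefore stable under \<open>\<Sum>\<^sub>i :e\<^sub>i(r\<^sub>1) \<dots> e\<^sub>i(r\<^sub>s):\<close> for each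
  single tuple with at most one negative entry (\<open>power_sum_modes_closed\<close>).

  The hypothesis on \<open>2\<close>-cycles says that for \<open>i \<noteq> j\<close> some \<open>n\<close> has \<open>\<lambda>(e\<^sub>i(n)) \<noteq> \<lambda>(e\<^sub>j(n))\<close>. Then
  \<open>e(n) - \<lambda>(e\<^sub>i(n))\<close> is locally nilpotent on the \<open>i\<close>-th tensor factor and locally invertible on the
  \<open>j\<close>-th one, so a polynomial in it kills a given vector of the former and fixes a given vector of
  the latter (\<open>kill_component\<close>). Inserting such polynomials into the sums over \<open>i\<close> leaves a single
  summand, and the subspace is stable under every \<open>e\<^sub>j(k)\<close> (\<open>mode_closed\<close>). Now a nonzero vector can
  be differentiated down to a nonzero constant (\<open>one_in_invariant_subspace\<close>), and \<open>1\<close> generates the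
  module.

  The mode \<open>v\<^sub>m\<close> is defined through an arbitrary expression of \<open>v\<close> in negative modes. It depends on
  \<open>v\<close> only, because it is determined by the polynomial that represents \<open>v\<close>
  (\<open>pol_word_mode_eq_pol_field\<close>); the reason is that forming normally ordered products with
  different \<open>a(z)\<close> are commuting operations on fields (\<open>nop_commute\<close>).
\<close>

section \<open>Linear extension of functions on a basis\<close>

definition lin_ext :: "('k \<Rightarrow> 'a \<Rightarrow> 'b) \<Rightarrow> ('k \<Rightarrow>\<^sub>0 'a::zero) \<Rightarrow> 'b::comm_monoid_add" where
  "lin_ext h p = (\<Sum>k\<in>Poly_Mapping.keys p. h k (Poly_Mapping.lookup p k))"

lemma lin_ext_superset:
  assumes "finite K" "Poly_Mapping.keys p \<subseteq> K" "\<And>k. h k 0 = 0"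
  shows "lin_ext h p = (\<Sum>k\<in>K. h k (Poly_Mapping.lookup p k))"
  unfolding lin_ext_def
  by (rule sum.mono_neutral_left) (use assms in \<open>auto simp: in_keys_iff\<close>)

lemma lin_ext_zero [simp]: "lin_ext h 0 = 0"
  by (simp add: lin_ext_def)

lemma lin_ext_single:
  assumes "\<And>k. h k 0 = 0"
  shows "lin_ext h (Poly_Mapping.single k c) = h k c"
  using assms by (simp add: lin_ext_def)

lemma lin_ext_add:
  fixes p q :: "'k \<Rightarrow>\<^sub>0 'a::comm_monoid_add"
  assumes "\<And>k. h k 0 = 0" "\<And>k a b. h k (a + b) = h k a + h k b"
  shows "lin_ext h (p + q) = lin_ext h p + lin_ext h q"
proof -
  let ?K = "Poly_Mapping.keys p \<union> Poly_Mapping.keys q"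
  have "lin_ext h (p + q) = (\<Sum>k\<in>?K. h k (Poly_Mapping.lookup (p + q) k))"
    by (rule lin_ext_superset) (use assms(1) Poly_Mapping.keys_add[of p q] in auto)
  also have "\<dots> = lin_ext h p + lin_ext h q"
    by (simp add: lookup_add assms(2) sum.distrib lin_ext_superset[of ?K p h]
        lin_ext_superset[of ?K q h] assms(1))
  finally show ?thesis .
qed

lemma lin_ext_fun_add: "lin_ext (\<lambda>k c. h k c + h' k c) p = lin_ext h p + lin_ext h' p"
  by (simp add: lin_ext_def sum.distrib)

lemma lin_ext_cong:
  assumes "\<And>k. k \<in> Poly_Mapping.keys p \<Longrightarrow>
    h k (Poly_Mapping.lookup p k) = h' k (Poly_Mapping.lookup p k)"
  shows "lin_ext h p = lin_ext h' p"
  using assms by (simp add: lin_ext_def)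

lemma lin_ext_singles: "lin_ext Poly_Mapping.single p = p"
proof (rule poly_mapping_eqI)
  fix k
  show "Poly_Mapping.lookup (lin_ext Poly_Mapping.single p) k = Poly_Mapping.lookup p k"
    by (cases "k \<in> Poly_Mapping.keys p")
      (auto simp: lin_ext_def lookup_sum lookup_single when_def sum.delta in_keys_iff)
qed

lemma poly_mapping_additive_induct [case_names zero single add]:
  fixes p :: "'k \<Rightarrow>\<^sub>0 'a::comm_monoid_add"
  assumes "P 0" "\<And>k c. k \<in> Poly_Mapping.keys p \<Longrightarrow> P (Poly_Mapping.single k c)"
    "\<And>p q. P p \<Longrightarrow> P q \<Longrightarrow> P (p + q)"
  shows "P p"
proof -
  have "P (\<Sum>k\<in>A. Poly_Mapping.single k (Poly_Mapping.lookup p k))"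
    if "finite A" "A \<subseteq> Poly_Mapping.keys p" for A
    using that by induction (auto intro!: assms)
  from this[of "Poly_Mapping.keys p"] show ?thesis
    by (simp add: lin_ext_def[symmetric] lin_ext_singles)
qed

section \<open>Polynomials in the creation operators\<close>

text \<open>
  The variable \<open>(i, k)\<close> stands for \<open>e\<^sub>i(-k-1)\<close>, so that every natural number \<open>k\<close> is admissible and is
  also the order of the derivative of \<open>a(z)\<close> in the vertex operator.
\<close>

type_synonym pol = "(nat \<times> nat) multiset \<Rightarrow>\<^sub>0 complex"

definition cst :: "complex \<Rightarrow> pol" where
  "cst c = Poly_Mapping.single 0 c"

definition var :: "nat \<times> nat \<Rightarrow> pol" where
  "var v = Poly_Mapping.single {#v#} 1"

definition partial :: "nat \<times> nat \<Rightarrow> pol \<Rightarrow> pol" where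
  "partial v = lin_ext (\<lambda>M c. Poly_Mapping.single (M - {#v#}) (of_nat (count M v) * c))"

lemma cst_simps [simp]:
  "cst 0 = 0" "cst 1 = 1" "cst (a + b) = cst a + cst b" "cst (a * b) = cst a * cst b"
  "cst (- a) = - cst a" "cst (a - b) = cst a - cst b"
  by (simp_all add: cst_def single_add mult_single single_uminus single_diff)

lemma cst_sum: "cst (sum g A) = (\<Sum>x\<in>A. cst (g x))"
  by (induction A rule: infinite_finite_induct) simp_all

lemma cst_mult_lookup: "Poly_Mapping.lookup (cst c * p) M = c * Poly_Mapping.lookup p M"
proof -
  have "Poly_Mapping.lookup (Poly_Mapping.map ((*) c) p) M = c * Poly_Mapping.lookup p M"
    by (simp add: map.rep_eq when_def)
  thus ?thesis by (simp add: cst_def mult_map_scale_conv_mult)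
qed

lemma pol_induct [case_names zero const var add]:
  assumes "P 0" "\<And>c. P (cst c)" "\<And>v p. P p \<Longrightarrow> P (var v * p)" "\<And>p q. P p \<Longrightarrow> P q \<Longrightarrow> P (p + q)"
  shows "P p"
proof (induction p rule: poly_mapping_additive_induct)
  case (single M c)
  show ?case
  proof (induction M)
    case empty
    then show ?case using assms(2)[of c] by (simp add: cst_def zero_multiset_def)
  next
    case (add v M)
    have "Poly_Mapping.single (add_mset v M) c = var v * Poly_Mapping.single M c"
      by (simp add: var_def mult_single)
    then show ?case using assms(3)[OF add] by simp
  qed
qed (use assms in auto)

lemma partial_single:
  "partial v (Poly_Mapping.single M c) = Poly_Mapping.single (M - {#v#}) (of_nat (count M v) * c)"
  by (simp add: partial_def lin_ext_single)

lemma partial_add [simp]: "partial v (p + q) = partial v p + partial v q"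
  unfolding partial_def by (rule lin_ext_add) (simp_all add: single_add ring_distribs)

lemma partial_zero [simp]: "partial v 0 = 0"
  by (simp add: partial_def)

lemma partial_var_mult: "partial v (var u * p) = (if u = v then p else 0) + var u * partial v p"
proof (induction p rule: poly_mapping_additive_induct)
  case (single M c)
  have 1: "partial v (var u * Poly_Mapping.single M c) =
      Poly_Mapping.single (add_mset u M - {#v#}) (of_nat (count (add_mset u M) v) * c)"
    by (simp add: var_def mult_single partial_single)
  have 2: "var u * partial v (Poly_Mapping.single M c) =
      Poly_Mapping.single (add_mset u (M - {#v#})) (of_nat (count M v) * c)"
    by (simp add: var_def mult_single partial_single)
  show ?case
  proof (cases "v \<in># M")
    case True
    hence "add_mset u M - {#v#} = add_mset u (M - {#v#})" by (rule diff_union_swap2)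
    moreover have "add_mset v (M - {#v#}) = M" using True by simp
    ultimately show ?thesis unfolding 1 2
      by (cases "u = v") (simp_all add: ring_distribs single_add)
  next
    case False
    hence "count M v = 0" by (simp add: not_in_iff)
    thus ?thesis unfolding 1 2 by (cases "u = v") simp_all
  qed
qed (simp_all add: ring_distribs)

lemma partial_cst_mult [simp]: "partial v (cst c * p) = cst c * partial v p"
proof (induction p rule: poly_mapping_additive_induct)
  case (single M a)
  show ?case by (simp add: cst_def mult_single partial_single mult.left_commute)
qed (simp_all add: ring_distribs)

lemma partial_cst [simp]: "partial v (cst c) = 0"
  by (simp add: cst_def partial_single)

lemma partial_commute: "partial u (partial v p) = partial v (partial u p)"
  by (induction p rule: pol_induct) (auto simp: partial_var_mult ring_distribs)

lemma lookup_partial: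
  "Poly_Mapping.lookup (partial v p) M = of_nat (Suc (count M v)) * Poly_Mapping.lookup p (add_mset v M)"
proof (induction p rule: poly_mapping_additive_induct)
  case (single K c)
  show ?case
  proof (cases "v \<in># K")
    case True
    hence "K - {#v#} = M \<longleftrightarrow> K = add_mset v M" by auto
    thus ?thesis by (auto simp: partial_single lookup_single when_def)
  next
    case False
    hence "count K v = 0" "K \<noteq> add_mset v M" by (auto simp: not_in_iff)
    thus ?thesis by (simp add: partial_single lookup_single)
  qed
qed (simp_all add: lookup_add ring_distribs)

lemma partial_nilpotent: "\<exists>N. ((partial v) ^^ N) p = 0"
proof (induction p rule: poly_mapping_additive_induct)
  case (single M c)
  show ?case
  proof (induction "count M v" arbitrary: M c)
    case 0
    then show ?case by (intro exI[of _ 1]) (simp add: partial_single)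
  next
    case (Suc n)
    have "n = count (M - {#v#}) v" using Suc(2) by simp
    from Suc(1)[OF this] obtain N where
      "((partial v) ^^ N) (Poly_Mapping.single (M - {#v#}) (of_nat (count M v) * c)) = 0" by blast
    then show ?case
      by (intro exI[of _ "Suc N"]) (simp add: partial_single funpow_Suc_right del: funpow.simps)
  qed
next
  case (add p q)
  then obtain N K where N: "((partial v) ^^ N) p = 0" "((partial v) ^^ K) q = 0" by blast
  have a: "((partial v) ^^ n) (x + y) = ((partial v) ^^ n) x + ((partial v) ^^ n) y" for n x y
    by (induction n) auto
  have z: "((partial v) ^^ n) 0 = 0" for n by (induction n) auto
  have "((partial v) ^^ (K + N)) p = 0" "((partial v) ^^ (N + K)) q = 0"
    using N z by (simp_all add: funpow_add)
  then show ?case by (intro exI[of _ "N + K"]) (simp add: a add.commute[of N K])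
qed (rule exI[of _ 0], simp)

section \<open>The Heisenberg operators on polynomials\<close>

text \<open>
  The operator by which \<open>e\<^sub>i(n)\<close> acts on the Whittaker module, where \<open>mu i n\<close> is the eigenvalue of
  \<open>e\<^sub>i(n)\<close> on the generating vector. For \<open>n = 0\<close> the derivative term is multiplied by \<open>0\<close>.
\<close>

definition mode_op :: "(nat \<Rightarrow> nat \<Rightarrow> complex) \<Rightarrow> nat \<Rightarrow> int \<Rightarrow> pol \<Rightarrow> pol" where
  "mode_op mu i n p =
     (if n < 0 then var (i, nat (- n - 1)) * p
      else cst (of_int n) * partial (i, nat (n - 1)) p + cst (mu i (nat n)) * p)"

lemma mode_op_linear [simp]:
  shows mode_op_add: "mode_op mu i n (p + q) = mode_op mu i n p + mode_op mu i n q"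
    and mode_op_zero: "mode_op mu i n 0 = 0"
    and mode_op_cst_mult: "mode_op mu i n (cst c * p) = cst c * mode_op mu i n p"
proof -
  show "mode_op mu i n (p + q) = mode_op mu i n p + mode_op mu i n q"
    unfolding mode_op_def partial_add by (simp only: distrib_left add_ac split: if_split) simp
  show "mode_op mu i n 0 = 0"
    by (simp add: mode_op_def)
  show "mode_op mu i n (cst c * p) = cst c * mode_op mu i n p"
    unfolding mode_op_def partial_cst_mult by (simp only: distrib_left mult_ac split: if_split) simp
qed

lemma mode_op_sum: "mode_op mu i n (sum g A) = (\<Sum>x\<in>A. mode_op mu i n (g x))"
  by (induction A rule: infinite_finite_induct) simp_all

lemma mode_op_commute_same_sign:
  assumes "m < 0 \<longleftrightarrow> n < 0"
  shows "mode_op mu i m (mode_op mu j n p) = mode_op mu j n (mode_op mu i m p)"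
proof (cases "m < 0")
  case True
  with assms show ?thesis by (simp add: mode_op_def mult.left_commute)
next
  case False
  with assms show ?thesis
    by (simp add: mode_op_def distrib_left mult.left_commute partial_commute[of "(i, nat (m - 1))"])
qed

lemma mode_op_commute_opposite_sign:
  assumes "m \<ge> 0" "n < 0"
  shows "mode_op mu i m (mode_op mu j n p) =
    mode_op mu j n (mode_op mu i m p) + (if i = j \<and> m + n = 0 then cst (of_int m) * p else 0)"
proof -
  have *: "(j, nat (- n - 1)) = (i, nat (m - 1)) \<longleftrightarrow> i = j \<and> m + n = 0" if "m \<noteq> 0"
    using assms that by auto
  show ?thesis
  proof (cases "m = 0")
    case True
    with assms show ?thesis by (simp add: mode_op_def mult.left_commute)
  next
    case False
    with assms show ?thesis
      by (simp add: mode_op_def partial_var_mult distrib_left mult.left_commute)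
        (use *[OF False] in auto)
  qed
qed

lemma mode_op_commutator:
  "mode_op mu i m (mode_op mu j n p) =
     mode_op mu j n (mode_op mu i m p) + (if i = j \<and> m + n = 0 then cst (of_int m) * p else 0)"
proof -
  consider "m < 0 \<longleftrightarrow> n < 0" | "m \<ge> 0" "n < 0" | "m < 0" "n \<ge> 0" by linarith
  then show ?thesis
  proof cases
    case 1
    hence "cst (of_int m) = 0" if "m + n = 0"
      using that by (cases "m = 0") auto
    with mode_op_commute_same_sign[OF 1, of mu i j p] show ?thesis by simp
  next
    case 2
    then show ?thesis by (rule mode_op_commute_opposite_sign)
  next
    case 3
    have "cst (of_int m) = - cst (of_int n)" if "m + n = 0"
    proof -
      from that have "m = - n" by simp
      thus ?thesis by simp
    qed
    thus ?thesis unfolding mode_op_commute_opposite_sign[OF 3(2,1), of mu j i p]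
      by (simp add: add.commute[of n m] eq_commute[of j i])
  qed
qed

section \<open>Normally ordered products of fields\<close>

text \<open>
  Only variables \<open>(i, k)\<close> with \<open>k < B\<close> occur in \<open>p\<close>. The formulation by derivatives reduces the
  stability under \<open>e\<^sub>i(n)\<close> with \<open>n \<ge> 0\<close> to the fact that derivatives commute.
\<close>

definition bounded_vars :: "int \<Rightarrow> pol \<Rightarrow> bool" where
  "bounded_vars B p \<longleftrightarrow> (\<forall>i k. int k \<ge> B \<longrightarrow> partial (i, k) p = 0)"

lemma bounded_vars_closed:
  "bounded_vars B p \<Longrightarrow> bounded_vars B q \<Longrightarrow> bounded_vars B (p + q)"
  "bounded_vars B p \<Longrightarrow> bounded_vars B (cst c * p)"
  "bounded_vars B p \<Longrightarrow> B \<le> B' \<Longrightarrow> bounded_vars B' p"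
  by (auto simp: bounded_vars_def)

lemma bounded_vars_mode_op:
  assumes "bounded_vars B p" "n \<ge> 0"
  shows "bounded_vars B (mode_op mu i n p)"
proof -
  have "partial (j, k) (partial (i, m) p) = 0" if "int k \<ge> B" for j k m
    using assms(1) that by (subst partial_commute) (simp add: bounded_vars_def)
  with assms show ?thesis by (simp add: bounded_vars_def mode_op_def)
qed

lemma ex_bounded_vars: "\<exists>B\<ge>B0. bounded_vars B p"
proof (induction p rule: pol_induct)
  case (var v p)
  then obtain B where B: "B \<ge> B0" "bounded_vars B p" by blast
  show ?case
  proof (intro exI[of _ "max B (int (snd v) + 1)"] conjI)
    show "bounded_vars (max B (int (snd v) + 1)) (var v * p)"
      using B(2) by (auto simp: bounded_vars_def partial_var_mult)
  qed (use B in auto)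
next
  case (add p q)
  then obtain B C where B: "B \<ge> B0" "bounded_vars B p" "C \<ge> B0" "bounded_vars C q" by blast
  show ?case
    by (rule exI[of _ "max B C"]) (use B in \<open>auto intro!: bounded_vars_closed(1) elim: bounded_vars_closed(3)\<close>)
qed (auto simp: bounded_vars_def)

text \<open>
  The condition on a Whittaker function, with a bound that is uniform in \<open>i\<close>.
\<close>

locale truncated_eigenvalues =
  fixes mu :: "nat \<Rightarrow> nat \<Rightarrow> complex" and B0 :: int
  assumes mu_eq_0: "B0 < int n \<Longrightarrow> mu i n = 0" and B0_nonneg: "0 \<le> B0"
begin

abbreviation "A \<equiv> mode_op mu"

lemma mode_op_eq_0:
  assumes "bounded_vars B p" "B0 \<le> B" "B < n"
  shows "A i n p = 0"
proof -
  have "mu i (nat n) = 0" using assms B0_nonneg by (intro mu_eq_0) auto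
  with assms B0_nonneg show ?thesis by (simp add: mode_op_def bounded_vars_def)
qed

text \<open>
  The operators \<open>F d\<close> are the coefficients of a series \<open>\<Sum>d. F d z^(-d)\<close>. The truncation \<open>F d p = 0\<close>
  for large \<open>d\<close> is required uniformly for all \<open>p\<close> in the variables below a bound. Since \<open>e\<^sub>i(r)\<close> with
  \<open>r \<ge> 0\<close> does not introduce new variables, this uniform version passes to normally ordered products.
\<close>

definition truncated_field :: "(int \<Rightarrow> pol \<Rightarrow> pol) \<Rightarrow> bool" where
  "truncated_field F \<longleftrightarrow>
     (\<forall>d p q. F d (p + q) = F d p + F d q) \<and>
     (\<forall>d c p. F d (cst c * p) = cst c * F d p) \<and>
     (\<forall>B\<ge>B0. \<exists>N. \<forall>d>N. \<forall>p. bounded_vars B p \<longrightarrow> F d p = 0)"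

lemma truncated_fieldD:
  assumes "truncated_field F"
  shows "F d (p + q) = F d p + F d q" "F d (cst c * p) = cst c * F d p" "F d 0 = 0"
proof -
  show "F d (p + q) = F d p + F d q" "F d (cst c * p) = cst c * F d p"
    using assms by (auto simp: truncated_field_def)
  have "F d (cst 0 * 0) = cst 0 * F d 0" using assms unfolding truncated_field_def by blast
  thus "F d 0 = 0" by simp
qed

lemma field_add:
  assumes "truncated_field F" "truncated_field G"
  shows "truncated_field (\<lambda>d p. F d p + G d p)"
  unfolding truncated_field_def
proof (intro conjI allI impI)
  fix B assume "B0 \<le> B"
  then obtain N K where "\<forall>d>N. \<forall>p. bounded_vars B p \<longrightarrow> F d p = 0"
    "\<forall>d>K. \<forall>p. bounded_vars B p \<longrightarrow> G d p = 0" using assms unfolding truncated_field_def by blast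
  thus "\<exists>N. \<forall>d>N. \<forall>p. bounded_vars B p \<longrightarrow> F d p + G d p = 0"
    by (intro exI[of _ "max N K"]) simp
qed (simp_all add: truncated_fieldD[OF assms(1)] truncated_fieldD[OF assms(2)] ring_distribs)

lemma field_scale:
  assumes "truncated_field F"
  shows "truncated_field (\<lambda>d p. cst a * F d p)"
  unfolding truncated_field_def
proof (intro conjI allI impI)
  fix B assume "B0 \<le> B"
  then obtain N where "\<forall>d>N. \<forall>p. bounded_vars B p \<longrightarrow> F d p = 0"
    using assms unfolding truncated_field_def by blast
  thus "\<exists>N. \<forall>d>N. \<forall>p. bounded_vars B p \<longrightarrow> cst a * F d p = 0" by (intro exI[of _ N]) simp
qed (simp_all add: truncated_fieldD[OF assms] distrib_left mult.left_commute)

lemma field_zero: "truncated_field (\<lambda>_ _. 0)"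
  by (simp add: truncated_field_def)

lemma field_shift:
  assumes "truncated_field F"
  shows "truncated_field (\<lambda>d. F (d - s))"
  unfolding truncated_field_def
proof (intro conjI allI impI)
  fix B assume "B0 \<le> B"
  then obtain N where "\<forall>d>N. \<forall>p. bounded_vars B p \<longrightarrow> F d p = 0"
    using assms unfolding truncated_field_def by blast
  thus "\<exists>N. \<forall>d>N. \<forall>p. bounded_vars B p \<longrightarrow> F (d - s) p = 0"
    by (intro exI[of _ "N + s"]) simp
qed (simp_all add: truncated_fieldD[OF assms])

definition nop_term ::
  "(int \<Rightarrow> complex) \<Rightarrow> nat \<Rightarrow> (int \<Rightarrow> pol \<Rightarrow> pol) \<Rightarrow> int \<Rightarrow> pol \<Rightarrow> int \<Rightarrow> pol" where
  "nop_term c i F d p r =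
     cst (c r) * (if r < 0 then A i r (F (d - r) p) else F (d - r) (A i r p))"

text \<open>
  The normally ordered product \<open>:a(z)F(z):\<close> with \<open>a(z) = \<Sum>r. c(r) e\<^sub>i(r) z^(-r)\<close>. A vertex operator
  only uses binomial coefficients for \<open>c\<close>; arbitrary \<open>c\<close> are allowed because interpolation replaces
  them by the indicator function of a single mode.
\<close>

definition nop ::
  "(int \<Rightarrow> complex) \<Rightarrow> nat \<Rightarrow> (int \<Rightarrow> pol \<Rightarrow> pol) \<Rightarrow> int \<Rightarrow> pol \<Rightarrow> pol" where
  "nop c i F d p = Sum_any (nop_term c i F d p)"

text \<open>
  For \<open>r > B\<close> the operator \<open>e\<^sub>i(r)\<close> kills \<open>p\<close>, and for \<open>r < d - N\<close> the degree \<open>d - r\<close> is beyond the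
  truncation of \<open>F\<close>.
\<close>

lemma nop_term_eq_0:
  assumes "truncated_field F" "bounded_vars B p" "B0 \<le> B"
    "\<And>d p. N < d \<Longrightarrow> bounded_vars B p \<Longrightarrow> F d p = 0" "r \<notin> {d - N..B}"
  shows "nop_term c i F d p r = 0"
proof (cases "r < 0")
  case True
  with assms B0_nonneg have "N < d - r" by auto
  with True assms(4)[of "d - r" p] assms(2) show ?thesis by (simp add: nop_term_def)
next
  case False
  show ?thesis
  proof (cases "r > B")
    case True
    with False mode_op_eq_0[OF assms(2,3), of r i] truncated_fieldD(3)[OF assms(1)]
    show ?thesis by (simp add: nop_term_def)
  next
    case False2: False
    with assms have "N < d - r" by auto
    with False assms(4)[of "d - r" "A i r p"] bounded_vars_mode_op[OF assms(2), of r mu i]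
    show ?thesis by (simp add: nop_term_def)
  qed
qed

lemma nop_eq_sum:
  assumes "truncated_field F" "bounded_vars B p" "B0 \<le> B"
    "\<And>d p. N < d \<Longrightarrow> bounded_vars B p \<Longrightarrow> F d p = 0" "finite R" "{d - N..B} \<subseteq> R"
  shows "nop c i F d p = (\<Sum>r\<in>R. nop_term c i F d p r)"
  unfolding nop_def
  by (rule Sum_any.expand_superset) (use nop_term_eq_0[OF assms(1-4)] assms(5,6) in blast)+

lemma finite_nop_terms:
  assumes "truncated_field F"
  shows "finite {r. nop_term c i F d p r \<noteq> 0}"
proof -
  obtain B where B: "B \<ge> B0" "bounded_vars B p" using ex_bounded_vars by blast
  with assms obtain N where "\<And>d p. N < d \<Longrightarrow> bounded_vars B p \<Longrightarrow> F d p = 0"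
    unfolding truncated_field_def by blast
  from nop_term_eq_0[OF assms B(2,1) this]
  have "{r. nop_term c i F d p r \<noteq> 0} \<subseteq> {d - N..B}" by blast
  thus ?thesis by (rule finite_subset) simp
qed

lemma nop_truncated:
  assumes "truncated_field F" "B0 \<le> B" "\<And>d p. N < d \<Longrightarrow> bounded_vars B p \<Longrightarrow> F d p = 0"
    "bounded_vars B p" "N + B < d"
  shows "nop c i F d p = 0"
proof -
  have "{d - N..B} \<subseteq> {}" using assms(5) by auto
  from nop_eq_sum[OF assms(1,4,2,3) _ this] show ?thesis by simp
qed

lemma nop_add_arg:
  assumes "truncated_field F"
  shows "nop c i F d (p + q) = nop c i F d p + nop c i F d q"
proof -
  have "nop_term c i F d (p + q) r = nop_term c i F d p r + nop_term c i F d q r" for r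
    by (simp add: nop_term_def truncated_fieldD[OF assms] distrib_left)
  hence "nop c i F d (p + q) = Sum_any (\<lambda>r. nop_term c i F d p r + nop_term c i F d q r)"
    by (simp add: nop_def)
  also have "\<dots> = nop c i F d p + nop c i F d q" unfolding nop_def
    by (rule Sum_any.distrib) (rule finite_nop_terms[OF assms])+
  finally show ?thesis .
qed

lemma nop_scale_arg:
  assumes "truncated_field F"
  shows "nop c i F d (cst a * p) = cst a * nop c i F d p"
proof -
  have "nop_term c i F d (cst a * p) r = cst a * nop_term c i F d p r" for r
    by (simp add: nop_term_def truncated_fieldD[OF assms] mult.left_commute)
  hence "nop c i F d (cst a * p) = Sum_any (\<lambda>r. cst a * nop_term c i F d p r)"
    by (simp add: nop_def)
  also have "\<dots> = cst a * nop c i F d p" unfolding nop_def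
    by (rule Sum_any_right_distrib[symmetric]) (rule finite_nop_terms[OF assms])
  finally show ?thesis .
qed

lemma nop_add_field:
  assumes "truncated_field F" "truncated_field G"
  shows "nop c i (\<lambda>d p. F d p + G d p) d p = nop c i F d p + nop c i G d p"
proof -
  have "nop_term c i (\<lambda>d p. F d p + G d p) d p r = nop_term c i F d p r + nop_term c i G d p r" for r
    by (simp add: nop_term_def distrib_left)
  hence "nop c i (\<lambda>d p. F d p + G d p) d p =
      Sum_any (\<lambda>r. nop_term c i F d p r + nop_term c i G d p r)"
    by (simp add: nop_def)
  also have "\<dots> = nop c i F d p + nop c i G d p" unfolding nop_def
    by (rule Sum_any.distrib) (rule finite_nop_terms, fact assms)+
  finally show ?thesis .
qed

lemma nop_add_coeff:
  assumes "truncated_field F"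
  shows "nop (\<lambda>r. c r + c' r) i F d p = nop c i F d p + nop c' i F d p"
proof -
  have "nop_term (\<lambda>r. c r + c' r) i F d p r = nop_term c i F d p r + nop_term c' i F d p r" for r
    by (simp add: nop_term_def distrib_right)
  hence "nop (\<lambda>r. c r + c' r) i F d p = Sum_any (\<lambda>r. nop_term c i F d p r + nop_term c' i F d p r)"
    by (simp add: nop_def)
  also have "\<dots> = nop c i F d p + nop c' i F d p" unfolding nop_def
    by (rule Sum_any.distrib) (rule finite_nop_terms[OF assms])+
  finally show ?thesis .
qed

lemma nop_scale_coeff:
  assumes "truncated_field F"
  shows "nop (\<lambda>r. a * c r) i F d p = cst a * nop c i F d p"
proof -
  have "nop_term (\<lambda>r. a * c r) i F d p r = cst a * nop_term c i F d p r" for r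
    by (simp add: nop_term_def mult.assoc)
  hence "nop (\<lambda>r. a * c r) i F d p = Sum_any (\<lambda>r. cst a * nop_term c i F d p r)"
    by (simp add: nop_def)
  also have "\<dots> = cst a * nop c i F d p" unfolding nop_def
    by (rule Sum_any_right_distrib[symmetric]) (rule finite_nop_terms[OF assms])
  finally show ?thesis .
qed

lemma nop_scale_field:
  assumes "truncated_field F"
  shows "nop c i (\<lambda>d p. cst a * F d p) d p = cst a * nop c i F d p"
proof -
  have "nop_term c i (\<lambda>d p. cst a * F d p) d p = nop_term (\<lambda>r. a * c r) i F d p"
    by (intro ext) (simp add: nop_term_def mult_ac)
  thus ?thesis using nop_scale_coeff[OF assms, of a c i d p] by (simp add: nop_def)
qed

lemma field_nop:
  assumes "truncated_field F"
  shows "truncated_field (nop c i F)"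
  unfolding truncated_field_def
proof (intro conjI allI impI)
  fix B assume B: "B0 \<le> B"
  then obtain N where "\<And>d p. N < d \<Longrightarrow> bounded_vars B p \<Longrightarrow> F d p = 0"
    using assms unfolding truncated_field_def by blast
  from nop_truncated[OF assms B this]
  show "\<exists>N. \<forall>d>N. \<forall>p. bounded_vars B p \<longrightarrow> nop c i F d p = 0" by blast
qed (simp_all add: nop_add_arg[OF assms] nop_scale_arg[OF assms])

text \<open>
  In both iterated products the modes \<open>r < 0\<close> stand to the left of \<open>F\<close> and those with \<open>r \<ge> 0\<close> to its
  right. Modes on the same side commute, so the two double sums agree term by term.
\<close>

lemma nop_commute:
  assumes F: "truncated_field F"
  shows "nop c i (nop c' j F) d p = nop c' j (nop c i F) d p"
proof -
  obtain B where B: "B \<ge> B0" "bounded_vars B p" using ex_bounded_vars by blast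
  then obtain N where N: "\<And>d p. N < d \<Longrightarrow> bounded_vars B p \<Longrightarrow> F d p = 0"
    using F unfolding truncated_field_def by blast
  \<comment> \<open>One range of modes that is large enough for the outer and for every inner sum.\<close>
  define R where "R = {d - (N + B)..B}"
  have R: "finite R" "{d - (N + B)..B} \<subseteq> R" by (simp_all add: R_def)
  define t where "t c i c' j r s = cst (c r) * (cst (c' s) *
      (if r < 0 then A i r (if s < 0 then A j s (F (d - r - s) p) else F (d - r - s) (A j s p))
       else if s < 0 then A j s (F (d - r - s) (A i r p)) else F (d - r - s) (A j s (A i r p))))"
    for c c' i j and r s :: int
  have expand: "nop c i (nop c' j F) d p = (\<Sum>r\<in>R. \<Sum>s\<in>R. t c i c' j r s)" for c c' i j
  proof -
    have inner: "nop c' j F (d - r) q = (\<Sum>s\<in>R. nop_term c' j F (d - r) q s)"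
      if "r \<in> R" "bounded_vars B q" for r q
      by (rule nop_eq_sum[OF F that(2) B(1) N R(1)]) (use that in \<open>auto simp: R_def\<close>)
    have "nop c i (nop c' j F) d p = (\<Sum>r\<in>R. nop_term c i (nop c' j F) d p r)"
      by (rule nop_eq_sum[OF field_nop[OF F] B(2,1) nop_truncated[OF F B(1) N] R])
    also have "\<dots> = (\<Sum>r\<in>R. \<Sum>s\<in>R. t c i c' j r s)"
    proof (rule sum.cong[OF refl])
      fix r assume r: "r \<in> R"
      show "nop_term c i (nop c' j F) d p r = (\<Sum>s\<in>R. t c i c' j r s)"
      proof (cases "r < 0")
        case True
        then show ?thesis
          by (simp add: nop_term_def[of c] inner[OF r B(2)] mode_op_sum sum_distrib_left)
            (simp add: nop_term_def t_def cong: if_cong)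
      next
        case False
        then show ?thesis
          by (simp add: nop_term_def[of c] inner[OF r bounded_vars_mode_op[OF B(2)]] sum_distrib_left)
            (simp add: nop_term_def t_def cong: if_cong)
      qed
    qed
    finally show ?thesis .
  qed
  have "t c i c' j r s = t c' j c i s r" for r s
  proof -
    have 1: "d - r - s = d - s - r" by simp
    have 2: "A i r (A j s q) = A j s (A i r q)" if "r < 0 \<longleftrightarrow> s < 0" for q
      using that by (rule mode_op_commute_same_sign)
    show ?thesis unfolding t_def 1
      by (cases "r < 0"; cases "s < 0") (simp_all add: 2 mult.left_commute)
  qed
  thus ?thesis unfolding expand by (subst sum.swap) simp
qed

lemma nop_shift: "nop c i (\<lambda>d. F (d - s)) d p = nop c i F (d - s) p"
proof -
  have "nop_term c i (\<lambda>d. F (d - s)) d p = nop_term c i F (d - s) p"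
    by (intro ext) (simp add: nop_term_def algebra_simps)
  thus ?thesis by (simp add: nop_def)
qed

section \<open>The vertex operator of a monomial\<close>

definition binomial_coeff :: "nat \<Rightarrow> int \<Rightarrow> complex" where
  "binomial_coeff k r = of_int (- r - 1) gchoose k"

text \<open>
  \<open>F \<mapsto> :(\<partial>^k a\<^sub>i(z) / k!) F(z):\<close> for \<open>v = (i, k)\<close>. Here \<open>m\<close> is the index of a mode, that is, the
  coefficient of \<open>z^(-m-1)\<close>; in this indexing \<open>\<partial>^k a\<^sub>i(z) / k!\<close> contributes the shift by \<open>k + 1\<close>.
\<close>

definition var_field :: "nat \<times> nat \<Rightarrow> (int \<Rightarrow> pol \<Rightarrow> pol) \<Rightarrow> int \<Rightarrow> pol \<Rightarrow> pol" where
  "var_field v F m = nop (binomial_coeff (snd v)) (fst v) F (m - int (snd v) - 1)"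

definition vacuum_field :: "int \<Rightarrow> pol \<Rightarrow> pol" where
  "vacuum_field m p = (if m = -1 then p else 0)"

text \<open>
  The sorted list only fixes an order of the variables; by \<open>foldr_var_field_insort\<close> every
  order gives the same field.
\<close>

definition monomial_field :: "(nat \<times> nat) multiset \<Rightarrow> int \<Rightarrow> pol \<Rightarrow> pol" where
  "monomial_field M = foldr var_field (sorted_list_of_multiset M) vacuum_field"

text \<open>
  The modes of \<open>Y(P, z)\<close>, where \<open>P\<close> is a vector of the Fock space written as a polynomial.
\<close>

definition pol_field :: "pol \<Rightarrow> int \<Rightarrow> pol \<Rightarrow> pol" where
  "pol_field P m p = lin_ext (\<lambda>M c. cst c * monomial_field M m p) P"

lemma field_vacuum_field: "truncated_field vacuum_field"
  unfolding truncated_field_def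
proof (intro conjI allI impI)
  show "\<exists>N. \<forall>d>N. \<forall>p. bounded_vars B p \<longrightarrow> vacuum_field d p = 0" for B
    by (intro exI[of _ 0]) (simp add: vacuum_field_def)
qed (simp_all add: vacuum_field_def)

lemma field_var_field: "truncated_field F \<Longrightarrow> truncated_field (var_field v F)"
  using field_shift[OF field_nop, of F _ _ "int (snd v) + 1"]
  by (simp add: var_field_def[abs_def] diff_diff_eq)

lemma var_field_commute: "truncated_field F \<Longrightarrow> var_field u (var_field v F) = var_field v (var_field u F)"
proof (intro ext)
  fix m p assume F: "truncated_field F"
  have *: "var_field u (var_field v F) m p =
      nop (binomial_coeff (snd u)) (fst u) (nop (binomial_coeff (snd v)) (fst v) F)
        (m - (int (snd u) + 1) - (int (snd v) + 1)) p" for u v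
    using nop_shift[of "binomial_coeff (snd u)" "fst u" "nop (binomial_coeff (snd v)) (fst v) F"
        "int (snd v) + 1" "m - (int (snd u) + 1)" p]
    by (simp add: var_field_def[abs_def] diff_diff_eq)
  have **: "m - (int (snd v) + 1) - (int (snd u) + 1) = m - (int (snd u) + 1) - (int (snd v) + 1)" by simp
  show "var_field u (var_field v F) m p = var_field v (var_field u F) m p"
    unfolding * ** by (rule nop_commute[OF F])
qed

lemma field_foldr: "truncated_field (foldr var_field vs vacuum_field)"
  by (induction vs) (simp_all add: field_vacuum_field field_var_field)

lemma foldr_var_field_insort:
  "foldr var_field (insort v vs) vacuum_field = var_field v (foldr var_field vs vacuum_field)"
  by (induction vs) (auto simp: var_field_commute[OF field_foldr])

lemma monomial_field_add_mset: "monomial_field (add_mset v M) = var_field v (monomial_field M)"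
  by (simp add: monomial_field_def foldr_var_field_insort)

lemma field_monomial_field: "truncated_field (monomial_field M)"
  by (simp add: monomial_field_def field_foldr)

lemma pol_field_add: "pol_field (P + Q) m p = pol_field P m p + pol_field Q m p"
  unfolding pol_field_def by (rule lin_ext_add) (simp_all add: distrib_right)

lemma pol_field_zero: "pol_field 0 m p = 0"
  by (simp add: pol_field_def)

lemma pol_field_single: "pol_field (Poly_Mapping.single M c) m p = cst c * monomial_field M m p"
  unfolding pol_field_def by (rule lin_ext_single) simp

lemma pol_field_cst_mult: "pol_field (cst c * P) m p = cst c * pol_field P m p"
proof (induction P rule: poly_mapping_additive_induct)
  case (single M a)
  have "cst c * Poly_Mapping.single M a = Poly_Mapping.single M (c * a)"
    by (simp add: cst_def mult_single)
  then show ?case by (simp add: pol_field_single mult.assoc)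
qed (simp_all add: pol_field_zero pol_field_add distrib_left)

lemma pol_field_one: "pol_field 1 = vacuum_field"
proof (intro ext)
  show "pol_field 1 m p = vacuum_field m p" for m p
    using pol_field_single[of 0 1 m p] by (simp add: monomial_field_def)
qed

lemma field_pol_field: "truncated_field (pol_field P)"
proof (induction P rule: poly_mapping_additive_induct)
  case zero
  then show ?case using field_zero by (simp add: pol_field_zero[abs_def])
next
  case (single M c)
  then show ?case using field_scale[OF field_monomial_field[of M], of c]
    by (simp add: pol_field_single[abs_def])
next
  case (add P Q)
  then show ?case using field_add[OF add] by (simp add: pol_field_add[abs_def])
qed

text \<open>
  The recursion \<open>Y(a(-k-1)P, z) = :(\<partial>^k a(z) / k!) Y(P, z):\<close>.
\<close>

lemma pol_field_var_mult: "pol_field (var v * P) m p = var_field v (pol_field P) m p"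
proof (induction P rule: poly_mapping_additive_induct)
  case zero
  show ?case using nop_scale_field[OF field_zero, of _ _ 0]
    by (simp add: pol_field_zero[abs_def] var_field_def)
next
  case (single M c)
  have "var v * Poly_Mapping.single M c = Poly_Mapping.single (add_mset v M) c"
    by (simp add: var_def mult_single)
  then show ?case
    by (simp add: pol_field_single[abs_def] monomial_field_add_mset
        var_field_def nop_scale_field[OF field_monomial_field])
next
  case (add P Q)
  have "pol_field (P + Q) = (\<lambda>m p. pol_field P m p + pol_field Q m p)"
    by (intro ext) (rule pol_field_add)
  with add show ?case
    by (simp add: distrib_left pol_field_add var_field_def nop_add_field[OF field_pol_field field_pol_field])
qed

lemma pol_field_prod_list: "pol_field (prod_list (map var vs)) = foldr var_field vs vacuum_field"
proof (induction vs)
  case (Cons v vs)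
  have "pol_field (var v * prod_list (map var vs)) = var_field v (pol_field (prod_list (map var vs)))"
    by (intro ext) (rule pol_field_var_mult)
  with Cons show ?case by simp
qed (simp add: pol_field_one)

lemma pol_field_sum: "pol_field (sum g I) m p = (\<Sum>i\<in>I. pol_field (g i) m p)"
  by (induction I rule: infinite_finite_induct) (simp_all add: pol_field_zero pol_field_add)

end

section \<open>Interpolation: isolating a single normally ordered monomial\<close>

context truncated_eigenvalues
begin

definition id_field :: "int \<Rightarrow> pol \<Rightarrow> pol" where
  "id_field d p = (if d = 0 then p else 0)"

text \<open>
  Products of several series \<open>\<Sum>r. g(r) e\<^sub>i(r) z^(-r)\<close> with the same \<open>i\<close>, indexed by the total degree
  \<open>d = r\<^sub>1 + \<dots> + r\<^sub>s\<close>. Unlike the index of a mode, \<open>d\<close> does not depend on the coefficients \<open>g\<close>, which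
  can therefore be varied independently.
\<close>

definition nop_list :: "nat \<Rightarrow> (int \<Rightarrow> complex) list \<Rightarrow> int \<Rightarrow> pol \<Rightarrow> pol" where
  "nop_list i gs = foldr (\<lambda>g. nop g i) gs id_field"

lemma nop_list_simps [simp]:
  "nop_list i [] = id_field" "nop_list i (g # gs) = nop g i (nop_list i gs)"
  by (simp_all add: nop_list_def)

lemma field_id_field: "truncated_field id_field"
  unfolding truncated_field_def
proof (intro conjI allI impI)
  show "\<exists>N. \<forall>d>N. \<forall>p. bounded_vars B p \<longrightarrow> id_field d p = 0" for B
    by (intro exI[of _ 0]) (simp add: id_field_def)
qed (simp_all add: id_field_def)

lemma field_nop_list: "truncated_field (nop_list i gs)"
  by (induction gs) (simp_all add: field_id_field field_nop)

lemma foldr_var_field_eq_nop_list: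
  "foldr var_field (map (Pair i) ks) vacuum_field =
     (\<lambda>m. nop_list i (map binomial_coeff ks) (m - (int (sum_list (map Suc ks)) - 1)))"
proof (induction ks)
  case Nil
  show ?case by (auto simp: vacuum_field_def id_field_def fun_eq_iff)
next
  case (Cons k ks)
  let ?s = "int (sum_list (map Suc ks)) - 1"
  have "foldr var_field (map (Pair i) (k # ks)) vacuum_field m =
      nop_list i (map binomial_coeff (k # ks)) (m - (int (sum_list (map Suc (k # ks))) - 1))" for m
  proof
    fix p
    have "m - int k - 1 - ?s = m - (int (sum_list (map Suc (k # ks))) - 1)" by simp
    thus "foldr var_field (map (Pair i) (k # ks)) vacuum_field m p =
        nop_list i (map binomial_coeff (k # ks)) (m - (int (sum_list (map Suc (k # ks))) - 1)) p"
      using nop_shift[of "binomial_coeff k" i "nop_list i (map binomial_coeff ks)" ?s "m - int k - 1" p]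
      by (simp only: list.map foldr.simps o_apply Cons.IH) (simp add: var_field_def)
  qed
  thus ?case by (intro ext) simp
qed

inductive_set polynomial_coeffs :: "(int \<Rightarrow> complex) set" where
  binomial: "binomial_coeff k \<in> polynomial_coeffs"
| add: "f \<in> polynomial_coeffs \<Longrightarrow> g \<in> polynomial_coeffs \<Longrightarrow> (\<lambda>r. f r + g r) \<in> polynomial_coeffs"
| scale: "f \<in> polynomial_coeffs \<Longrightarrow> (\<lambda>r. a * f r) \<in> polynomial_coeffs"

text \<open>
  With \<open>a = -r-1\<close> one has \<open>a binomial(a, k) = k binomial(a, k) + (k+1) binomial(a, k+1)\<close>, so the span
  of the binomials is stable under multiplication by \<open>r\<close> and consists of all polynomials in \<open>r\<close>.
\<close>

lemma polynomial_coeffs_mult: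
  assumes "f \<in> polynomial_coeffs"
  shows "(\<lambda>r. of_int r * f r) \<in> polynomial_coeffs"
  using assms
proof induction
  case (binomial k)
  have "of_int r * binomial_coeff k r =
      (- of_nat k - 1) * binomial_coeff k r + (- of_nat (Suc k)) * binomial_coeff (Suc k) r" for r
  proof -
    let ?a = "of_int (- r - 1) :: complex"
    have "of_int r * (?a gchoose k) = - (?a * (?a gchoose k)) - (?a gchoose k)"
      by (simp add: algebra_simps)
    also have "\<dots> = (- of_nat k - 1) * (?a gchoose k) + (- of_nat (Suc k)) * (?a gchoose Suc k)"
      unfolding gbinomial_mult_1 by (simp add: algebra_simps)
    finally show ?thesis unfolding binomial_coeff_def .
  qed
  thus ?case by (auto intro!: polynomial_coeffs.intros)
next
  case (add f g)
  then show ?case using polynomial_coeffs.add by (simp add: distrib_left)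
next
  case (scale f a)
  then show ?case using polynomial_coeffs.scale[of _ a] by (simp add: mult.left_commute)
qed

lemma interpolation:
  assumes "finite R"
  shows "\<exists>f\<in>polynomial_coeffs. f r0 = 1 \<and> (\<forall>r\<in>R - {r0}. f r = 0)"
  using assms
proof induction
  case empty
  have "binomial_coeff 0 r0 = 1" by (simp add: binomial_coeff_def)
  then show ?case using polynomial_coeffs.binomial by blast
next
  case (insert r1 R)
  then obtain f where f: "f \<in> polynomial_coeffs" "f r0 = 1" "\<forall>r\<in>R - {r0}. f r = 0" by blast
  show ?case
  proof (cases "r1 = r0")
    case True
    with f show ?thesis by auto
  next
    case False
    define b where "b = 1 / (of_int r0 - of_int r1 :: complex)"
    have b: "b * (of_int r0 - of_int r1) = 1" using False by (simp add: b_def)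
    let ?g = "\<lambda>r. b * (of_int r * f r) + (- b * of_int r1) * f r"
    have "?g \<in> polynomial_coeffs"
      using f(1) by (intro polynomial_coeffs.add polynomial_coeffs.scale polynomial_coeffs_mult)
    moreover have "?g r = b * (of_int r - of_int r1) * f r" for r
      by (simp add: algebra_simps)
    hence "?g r0 = 1" "\<forall>r\<in>insert r1 R - {r0}. ?g r = 0"
      using f b by (auto simp: right_diff_distrib)
    ultimately show ?thesis by (intro bexI[of _ ?g] conjI)
  qed
qed

lemma foldr_nop_add:
  assumes "truncated_field F" "truncated_field G"
  shows "foldr (\<lambda>g. nop g i) gs (\<lambda>d p. F d p + G d p) =
    (\<lambda>d p. foldr (\<lambda>g. nop g i) gs F d p + foldr (\<lambda>g. nop g i) gs G d p)"
proof (induction gs)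
  case (Cons g gs)
  have "truncated_field (foldr (\<lambda>g. nop g i) gs H)" if "truncated_field H" for H
    by (induction gs) (simp_all add: that field_nop)
  from nop_add_field[OF this[OF assms(1)] this[OF assms(2)]] Cons show ?case by auto
qed simp

lemma foldr_nop_scale:
  assumes "truncated_field F"
  shows "foldr (\<lambda>g. nop g i) gs (\<lambda>d p. cst a * F d p) =
    (\<lambda>d p. cst a * foldr (\<lambda>g. nop g i) gs F d p)"
proof (induction gs)
  case (Cons g gs)
  have "truncated_field (foldr (\<lambda>g. nop g i) gs F)"
    by (induction gs) (simp_all add: assms field_nop)
  from nop_scale_field[OF this] Cons show ?case by auto
qed simp

definition pol_subspace :: "pol set \<Rightarrow> bool" where
  "pol_subspace S \<longleftrightarrow> 0 \<in> S \<and> (\<forall>p\<in>S. \<forall>q\<in>S. p + q \<in> S) \<and> (\<forall>c. \<forall>p\<in>S. cst c * p \<in> S)"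

lemma pol_subspaceD:
  assumes "pol_subspace S"
  shows "0 \<in> S" "p \<in> S \<Longrightarrow> q \<in> S \<Longrightarrow> p + q \<in> S" "p \<in> S \<Longrightarrow> cst c * p \<in> S"
    "p \<in> S \<Longrightarrow> q \<in> S \<Longrightarrow> p - q \<in> S"
proof -
  show S: "0 \<in> S" "p \<in> S \<Longrightarrow> q \<in> S \<Longrightarrow> p + q \<in> S" "p \<in> S \<Longrightarrow> cst c * p \<in> S" for p q c
    using assms by (auto simp: pol_subspace_def)
  show "p \<in> S \<Longrightarrow> q \<in> S \<Longrightarrow> p - q \<in> S"
    using S(2)[of p "cst (- 1) * q"] S(3)[of q "- 1"] by simp
qed

text \<open>
  The product is linear in each coefficient function, so the binomials can be replaced by elements
  of their span one after the other.
\<close>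

lemma nop_list_multilinear:
  assumes S: "pol_subspace S"
    and base: "\<And>ks d. (\<Sum>i<l. nop_list i (map binomial_coeff ks) d p) \<in> S"
    and gs: "set gs \<subseteq> polynomial_coeffs"
  shows "(\<Sum>i<l. nop_list i (gs @ map binomial_coeff ks) d p) \<in> S"
  using gs
proof (induction gs arbitrary: ks rule: rev_induct)
  case Nil
  then show ?case using base by simp
next
  case (snoc g gs)
  have "(\<Sum>i<l. nop_list i (gs @ g # map binomial_coeff ks) d p) \<in> S"
    if "g \<in> polynomial_coeffs" for g
    using that
  proof induction
    case (binomial k)
    then show ?case using snoc.IH[of "k # ks"] snoc.prems by simp
  next
    case (add f g)
    have "nop_list i (gs @ (\<lambda>r. f r + g r) # map binomial_coeff ks) d p =
        nop_list i (gs @ f # map binomial_coeff ks) d p +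
        nop_list i (gs @ g # map binomial_coeff ks) d p" for i
    proof -
      let ?F = "nop_list i (map binomial_coeff ks)"
      have "nop (\<lambda>r. f r + g r) i ?F = (\<lambda>d p. nop f i ?F d p + nop g i ?F d p)"
        by (intro ext) (rule nop_add_coeff[OF field_nop_list])
      with foldr_nop_add[where F = "nop f i ?F" and G = "nop g i ?F" and i = i and gs = gs,
          OF field_nop[OF field_nop_list] field_nop[OF field_nop_list]]
      show ?thesis by (simp add: nop_list_def)
    qed
    with add pol_subspaceD(2)[OF S] show ?case by (simp add: sum.distrib)
  next
    case (scale f a)
    have "nop_list i (gs @ (\<lambda>r. a * f r) # map binomial_coeff ks) d p =
        cst a * nop_list i (gs @ f # map binomial_coeff ks) d p" for i
    proof -
      let ?F = "nop_list i (map binomial_coeff ks)"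
      have "nop (\<lambda>r. a * f r) i ?F = (\<lambda>d p. cst a * nop f i ?F d p)"
        by (intro ext) (rule nop_scale_coeff[OF field_nop_list])
      with foldr_nop_scale[where F = "nop f i ?F" and i = i and gs = gs and a = a,
          OF field_nop[OF field_nop_list]]
      show ?thesis by (simp add: nop_list_def)
    qed
    with scale pol_subspaceD(3)[OF S] show ?case by (simp add: sum_distrib_left[symmetric])
  qed
  with snoc.prems show ?case by simp
qed

lemma nop_list_truncated:
  assumes "B0 \<le> B"
  shows "bounded_vars B p \<Longrightarrow> int (length gs) * B < d \<Longrightarrow> nop_list i gs d p = 0"
proof (induction gs arbitrary: d p)
  case Nil
  then show ?case by (simp add: id_field_def)
next
  case (Cons g gs)
  have "nop_list i gs d p = 0" if "int (length gs) * B < d" "bounded_vars B p" for d p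
    using Cons.IH that by blast
  from nop_truncated[OF field_nop_list assms this Cons.prems(1), where c = g and d = d] Cons.prems(2)
  show ?case by (simp add: algebra_simps)
qed

text \<open>
  On \<open>p\<close> only finitely many values of the coefficient functions are visible: \<open>e\<^sub>i(r)\<close> acts as zero
  for \<open>r > B\<close>, and as the modes of a product of length \<open>s\<close> have sum \<open>d\<close>, none of them can be smaller
  than \<open>d - (s-1)B\<close>.
\<close>

lemma nop_list_cong:
  assumes "B0 \<le> B"
  shows "list_all2 (\<lambda>g h. \<forall>r\<in>{lo..B}. g r = h r) gs hs \<Longrightarrow> bounded_vars B p \<Longrightarrow>
    lo \<le> d - (int (length gs) - 1) * B \<Longrightarrow> nop_list i gs d p = nop_list i hs d p"
proof (induction gs hs arbitrary: d p rule: list_all2_induct)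
  case (Cons g gs h hs)
  let ?R = "{d - int (length gs) * B..B}"
  have len: "length gs = length hs" using Cons.hyps(2) by (rule list_all2_lengthD)
  have sum: "nop c i (nop_list i fs) d p = (\<Sum>r\<in>?R. nop_term c i (nop_list i fs) d p r)"
    if "length fs = length gs" for c fs
    by (rule nop_eq_sum[OF field_nop_list Cons.prems(1) assms]) (use that nop_list_truncated[OF assms] in auto)
  have "nop_term g i (nop_list i gs) d p r = nop_term h i (nop_list i hs) d p r" if r: "r \<in> ?R" for r
  proof -
    have lo: "lo \<le> d - int (length gs) * B" using Cons.prems(2) by simp
    with r have "g r = h r" using Cons.hyps(1) by simp
    moreover have "lo \<le> d - r - (int (length gs) - 1) * B"
      using lo r by (simp add: algebra_simps)
    ultimately show ?thesis
      using Cons.IH[of p "d - r"] Cons.IH[of "A i r p" "d - r"] Cons.prems(1)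
        bounded_vars_mode_op[OF Cons.prems(1), of r mu i]
      by (simp add: nop_term_def)
  qed
  thus ?case using len by (simp add: sum)
qed simp

definition delta :: "int \<Rightarrow> int \<Rightarrow> complex" where
  "delta r0 r = (if r = r0 then 1 else 0)"

lemma nop_delta:
  "nop (delta r) i F d p = (if r < 0 then A i r (F (d - r) p) else F (d - r) (A i r p))"
proof -
  have "nop (delta r) i F d p = (\<Sum>s\<in>{r}. nop_term (delta r) i F d p s)"
    unfolding nop_def by (rule Sum_any.expand_superset) (auto simp: nop_term_def delta_def)
  thus ?thesis by (simp add: nop_term_def delta_def)
qed

lemma nop_list_delta:
  assumes "\<forall>n\<in>set ns. n \<ge> 0"
  shows "nop_list i (map delta ns) (sum_list ns) p = fold (A i) ns p"
  using assms by (induction ns arbitrary: p) (auto simp: nop_delta id_field_def)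

lemma nop_list_delta_closed:
  assumes S: "pol_subspace S"
    and base: "\<And>ks d. (\<Sum>i<l. nop_list i (map binomial_coeff ks) d p) \<in> S"
  shows "(\<Sum>i<l. nop_list i (map delta rs) d p) \<in> S"
proof -
  obtain B where B: "B \<ge> B0" "bounded_vars B p" using ex_bounded_vars by blast
  define lo where "lo = d - (int (length rs) - 1) * B"
  have "\<forall>r0. \<exists>f\<in>polynomial_coeffs. \<forall>r\<in>{lo..B}. f r = delta r0 r"
  proof
    fix r0
    from interpolation[of "{lo..B}" r0] show "\<exists>f\<in>polynomial_coeffs. \<forall>r\<in>{lo..B}. f r = delta r0 r"
      by (auto simp: delta_def)
  qed
  then obtain f where f: "\<And>r0. f r0 \<in> polynomial_coeffs" "\<And>r0 r. r \<in> {lo..B} \<Longrightarrow> f r0 r = delta r0 r"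
    by metis
  have "nop_list i (map f rs) d p = nop_list i (map delta rs) d p" for i
    by (rule nop_list_cong[OF B(1) _ B(2)])
      (use f(2) in \<open>auto simp: lo_def list_all2_map1 list_all2_map2 intro!: list_all2_refl\<close>)
  moreover have "(\<Sum>i<l. nop_list i (map f rs @ map binomial_coeff []) d p) \<in> S"
    by (rule nop_list_multilinear[OF S base]) (use f(1) in auto)
  ultimately show ?thesis by simp
qed

text \<open>
  Interpolation turns the sum over all modes into a single product, and with at most one
  negative mode that product is already normally ordered.
\<close>

lemma power_sum_modes_closed:
  assumes S: "pol_subspace S"
    and base: "\<And>ks m. (\<Sum>i<l. foldr var_field (map (Pair i) ks) vacuum_field m p) \<in> S"
    and ns: "\<forall>n\<in>set ns. n \<ge> 0"
  shows "(\<Sum>i<l. A i k (fold (A i) ns p)) \<in> S"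
proof -
  have base': "(\<Sum>i<l. nop_list i (map binomial_coeff ks) d p) \<in> S" for ks d
    using base[of ks "d + (int (sum_list (map Suc ks)) - 1)"]
    by (simp add: foldr_var_field_eq_nop_list)
  note closed = nop_list_delta_closed[OF S base']
  show ?thesis
  proof (cases "k < 0")
    case True
    hence "nop_list i (map delta (k # ns)) (k + sum_list ns) p = A i k (fold (A i) ns p)" for i
      by (simp add: nop_delta nop_list_delta[OF ns])
    with closed[of "k # ns" "k + sum_list ns"] show ?thesis by simp
  next
    case False
    hence "nop_list i (map delta (ns @ [k])) (sum_list (ns @ [k])) p = A i k (fold (A i) ns p)" for i
      using nop_list_delta[of "ns @ [k]" i p] ns by auto
    with closed[of "ns @ [k]" "sum_list (ns @ [k])"] show ?thesis by simp
  qed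
qed

end

section \<open>Separating the tensor factors by their eigenvalues\<close>

lemma funpow_additive:
  fixes f :: "'a::ab_group_add \<Rightarrow> 'a"
  assumes "\<And>x y. f (x + y) = f x + f y"
  shows "(f ^^ n) (x + y) = (f ^^ n) x + (f ^^ n) y" "(f ^^ n) 0 = 0"
    "(f ^^ n) (x - y) = (f ^^ n) x - (f ^^ n) y"
proof -
  show add: "(f ^^ n) (x + y) = (f ^^ n) x + (f ^^ n) y" for x y
    by (induction n) (simp_all add: assms)
  from add[of 0 0] show "(f ^^ n) 0 = 0" by simp
  from add[of "x - y" y] show "(f ^^ n) (x - y) = (f ^^ n) x - (f ^^ n) y" by simp
qed

text \<open>
  The operator \<open>1 - (1 + \<delta>)^N\<close> is divisible by \<open>\<delta>\<close>; hence each application of it to a vector lowers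
  the exponent of \<open>\<delta>\<close> that annihilates the vector.
\<close>

lemma unipotent_power_minus_one_nilpotent:
  fixes \<delta> :: "'a::ab_group_add \<Rightarrow> 'a"
  assumes add: "\<And>x y. \<delta> (x + y) = \<delta> x + \<delta> y" and nil: "(\<delta> ^^ m) p = 0"
  shows "((\<lambda>x. x - ((\<lambda>x. x + \<delta> x) ^^ N) x) ^^ m) p = 0"
  using nil
proof (induction m arbitrary: p)
  case (Suc m)
  note Suc_prems = Suc.prems
  let ?e = "\<lambda>x. x + \<delta> x"
  note pow = funpow_additive[of \<delta>, OF add]
  have e_add: "?e (x + y) = ?e x + ?e y" for x y by (simp add: add add_ac)
  have comm: "(\<delta> ^^ k) ((?e ^^ n) x) = (?e ^^ n) ((\<delta> ^^ k) x)" for k n x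
  proof (induction n)
    case (Suc n)
    have "(\<delta> ^^ k) (?e y) = ?e ((\<delta> ^^ k) y)" for y
      by (simp add: pow funpow_swap1)
    with Suc show ?case by simp
  qed simp
  have "(\<delta> ^^ m) (p - (?e ^^ n) p) = 0" for n
  proof (induction n)
    case 0
    show ?case by (simp add: pow)
  next
    case (Suc n)
    have "(\<delta> ^^ m) (\<delta> ((?e ^^ n) p)) = (\<delta> ^^ Suc m) ((?e ^^ n) p)"
      by (simp add: funpow_swap1)
    also have "\<dots> = (?e ^^ n) ((\<delta> ^^ Suc m) p)" by (rule comm)
    also have "\<dots> = 0"
      unfolding Suc_prems by (rule funpow_additive(2)) (rule e_add)
    finally show ?case using Suc by (simp add: pow)
  qed
  from Suc.IH[OF this[of N]] show ?case by (simp only: funpow_Suc_right o_apply)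
qed simp

context truncated_eigenvalues
begin

text \<open>
  The modes of \<open>e\<^sub>i\<close> act on the \<open>i\<close>-th entry of a tuple. A polynomial in the modes thus acts on all
  entries at once, just as it enters all summands of \<open>\<Sum>\<^sub>i\<close> at once.
\<close>

definition closed_tuples :: "(nat \<Rightarrow> pol) set \<Rightarrow> bool" where
  "closed_tuples Q \<longleftrightarrow> (\<forall>q\<in>Q. \<forall>q'\<in>Q. (\<lambda>i. q i + q' i) \<in> Q) \<and> (\<forall>c. \<forall>q\<in>Q. (\<lambda>i. cst c * q i) \<in> Q) \<and>
     (\<forall>n. \<forall>q\<in>Q. (\<lambda>i. A i (int n) (q i)) \<in> Q)"

lemma closed_tuplesD:
  assumes "closed_tuples Q"
  shows "q \<in> Q \<Longrightarrow> q' \<in> Q \<Longrightarrow> (\<lambda>i. q i + q' i) \<in> Q" "q \<in> Q \<Longrightarrow> (\<lambda>i. cst c * q i) \<in> Q"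
    "q \<in> Q \<Longrightarrow> (\<lambda>i. A i (int n) (q i)) \<in> Q" "q \<in> Q \<Longrightarrow> q' \<in> Q \<Longrightarrow> (\<lambda>i. q i - q' i) \<in> Q"
proof -
  show Q: "q \<in> Q \<Longrightarrow> q' \<in> Q \<Longrightarrow> (\<lambda>i. q i + q' i) \<in> Q" "q \<in> Q \<Longrightarrow> (\<lambda>i. cst c * q i) \<in> Q"
    "q \<in> Q \<Longrightarrow> (\<lambda>i. A i (int n) (q i)) \<in> Q" for q q' c n
    using assms by (auto simp: closed_tuples_def)
  show "q \<in> Q \<Longrightarrow> q' \<in> Q \<Longrightarrow> (\<lambda>i. q i - q' i) \<in> Q"
    using Q(1)[of q "\<lambda>i. cst (- 1) * q' i"] Q(2)[of q' "- 1"] by simp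
qed

text \<open>
  Let \<open>t\<close> be \<open>e(n) - mu i0 n\<close> divided by \<open>mu j n - mu i0 n\<close>. It is locally nilpotent in position \<open>i0\<close>,
  and \<open>t - 1\<close> is locally nilpotent in position \<open>j\<close>. For large exponents \<open>1 - (1 - t^N1)^N\<close> is therefore
  zero on \<open>q i0\<close> and the identity on \<open>q j\<close>.
\<close>

lemma kill_component:
  assumes Q: "closed_tuples Q" "q \<in> Q" and ne: "mu i0 n \<noteq> mu j n"
  shows "\<exists>q'\<in>Q. q' j = q j \<and> q' i0 = 0 \<and> (\<forall>i. q i = 0 \<longrightarrow> q' i = 0)"
proof -
  define c where "c = 1 / (mu j n - mu i0 n)"
  define t where "t i p = cst c * (A i (int n) p - cst (mu i0 n) * p)" for i p
  define \<delta> where "\<delta> i p = cst (c * of_nat n) * partial (i, n - 1) p" for i p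
  have t_eq: "t i p = \<delta> i p + cst (c * (mu i n - mu i0 n)) * p" for i p
  proof -
    have "nat (int n - 1) = n - 1" by arith
    thus ?thesis by (simp add: t_def \<delta>_def mode_op_def algebra_simps)
  qed
  have t_i0: "t i0 = \<delta> i0" by (intro ext) (simp add: t_eq)
  have "c * (mu j n - mu i0 n) = 1" using ne by (simp add: c_def)
  hence t_j: "t j = (\<lambda>p. p + \<delta> j p)" by (intro ext) (simp add: t_eq add.commute del: cst_simps(4,6))
  have \<delta>_add: "\<delta> i (x + y) = \<delta> i x + \<delta> i y" for i x y by (simp add: \<delta>_def distrib_left)
  have t_add: "t i (x + y) = t i x + t i y" for i x y by (simp add: t_eq \<delta>_add distrib_left)
  have \<delta>_pow: "(\<delta> i ^^ m) p = cst ((c * of_nat n) ^ m) * (partial (i, n - 1) ^^ m) p" for i m p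
  proof (induction m)
    case (Suc m)
    then show ?case by (simp add: \<delta>_def[of i "cst _ * _"] mult_ac)
  qed simp
  obtain N1 where N1: "(partial (i0, n - 1) ^^ N1) (q i0) = 0" using partial_nilpotent by blast
  obtain N where N: "(partial (j, n - 1) ^^ N) (q j) = 0" using partial_nilpotent by blast
  have nil1: "(t i0 ^^ N1) (q i0) = 0" by (simp only: t_i0 \<delta>_pow N1 mult_zero_right)
  have nil: "(\<delta> j ^^ N) (q j) = 0" by (simp only: \<delta>_pow N mult_zero_right)
  define r where "r i p = p - (t i ^^ N1) p" for i p
  have r_add: "r i (x + y) = r i x + r i y" for i x y
    by (simp add: r_def funpow_additive(1)[of "t i", OF t_add])
  have t_Q: "(\<lambda>i. (t i ^^ m) (p i)) \<in> Q" if "p \<in> Q" for m p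
  proof (induction m)
    case (Suc m)
    from closed_tuplesD(2)[OF Q(1) closed_tuplesD(4)[OF Q(1) closed_tuplesD(3)[OF Q(1) Suc]
        closed_tuplesD(2)[OF Q(1) Suc]], of c n "mu i0 n"]
    show ?case by (simp add: t_def)
  qed (use that in simp)
  have r_Q: "(\<lambda>i. (r i ^^ m) (q i)) \<in> Q" for m
  proof (induction m)
    case (Suc m)
    from closed_tuplesD(4)[OF Q(1) Suc t_Q[OF Suc, of N1]] show ?case by (simp add: r_def)
  qed (use Q(2) in simp)
  have "r i0 (q i0) = q i0" by (simp add: r_def nil1)
  hence "(r i0 ^^ N) (q i0) = q i0" by (induction N) auto
  moreover have "(r j ^^ N) (q j) = 0"
    unfolding r_def t_j by (rule unipotent_power_minus_one_nilpotent[OF \<delta>_add nil])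
  moreover have "(r i ^^ N) 0 = 0" for i by (rule funpow_additive(2)) (rule r_add)
  ultimately show ?thesis
    using closed_tuplesD(4)[OF Q r_Q[of N]] by (intro bexI[of _ "\<lambda>i. q i - (r i ^^ N) (q i)"]) simp_all
qed

lemma isolate_component:
  assumes Q: "closed_tuples Q" "q \<in> Q" and I: "finite I" "\<And>i. i \<in> I \<Longrightarrow> \<exists>n. mu i n \<noteq> mu j n"
  shows "\<exists>q'\<in>Q. q' j = q j \<and> (\<forall>i\<in>I. q' i = 0)"
  using I
proof induction
  case (insert i0 I)
  then obtain q' where q': "q' \<in> Q" "q' j = q j" "\<forall>i\<in>I. q' i = 0" by auto
  obtain n where "mu i0 n \<noteq> mu j n" using insert.prems by blast
  from kill_component[OF Q(1) q'(1) this] q'(2,3) show ?case by auto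
qed (use Q in auto)

text \<open>
  The tuples whose images under \<open>\<Sum>\<^sub>i e\<^sub>i(k)\<close> stay in \<open>S\<close>, also after applying further modes, form a
  closed set, which contains the constant tuple \<open>p\<close>. Separating the factors gives the tuple with
  \<open>p\<close> in position \<open>j\<close> and zero elsewhere, for which the sum is \<open>e\<^sub>j(k) p\<close>.
\<close>

lemma mode_closed:
  assumes S: "pol_subspace S"
    and base: "\<And>ks m p. p \<in> S \<Longrightarrow> (\<Sum>i<l. foldr var_field (map (Pair i) ks) vacuum_field m p) \<in> S"
    and distinct: "\<And>i j. i < l \<Longrightarrow> j < l \<Longrightarrow> i \<noteq> j \<Longrightarrow> \<exists>n. mu i n \<noteq> mu j n"
    and p: "p \<in> S" and j: "j < l"
  shows "A j k p \<in> S"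
proof -
  define Q where "Q = {q. \<forall>ns. (\<forall>n\<in>set ns. n \<ge> 0) \<longrightarrow> (\<Sum>i<l. A i k (fold (A i) ns (q i))) \<in> S}"
  have fold_add: "fold (A i) ns (x + y) = fold (A i) ns x + fold (A i) ns y" for i ns x y
    by (induction ns arbitrary: x y) simp_all
  have fold_scale: "fold (A i) ns (cst c * x) = cst c * fold (A i) ns x" for i ns c x
    by (induction ns arbitrary: x) simp_all
  have "closed_tuples Q"
    unfolding closed_tuples_def
  proof (intro conjI ballI allI)
    fix q q' assume "q \<in> Q" "q' \<in> Q"
    thus "(\<lambda>i. q i + q' i) \<in> Q"
      using pol_subspaceD(2)[OF S] by (simp add: Q_def fold_add sum.distrib)
  next
    fix q c assume "q \<in> Q"
    thus "(\<lambda>i. cst c * q i) \<in> Q"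
      using pol_subspaceD(3)[OF S] by (simp add: Q_def fold_scale sum_distrib_left[symmetric])
  next
    fix q n assume q: "q \<in> Q"
    have "(\<Sum>i<l. A i k (fold (A i) (int n # ns) (q i))) \<in> S" if "\<forall>n\<in>set ns. n \<ge> 0" for ns
    proof -
      have "\<forall>m\<in>set (int n # ns). m \<ge> 0" using that by simp
      with q show ?thesis unfolding Q_def by blast
    qed
    thus "(\<lambda>i. A i (int n) (q i)) \<in> Q" by (simp add: Q_def)
  qed
  moreover have "(\<lambda>_. p) \<in> Q"
    using power_sum_modes_closed[OF S base[OF p]] by (simp add: Q_def)
  ultimately obtain q where q: "q \<in> Q" "q j = p" "\<forall>i\<in>{..<l} - {j}. q i = 0"
    using isolate_component[of Q "\<lambda>_. p" "{..<l} - {j}" j] distinct j by auto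
  have "(\<Sum>i<l. A i k (q i)) \<in> S" using q(1) unfolding Q_def by (auto dest: spec[of _ "[]"])
  also have "(\<Sum>i<l. A i k (q i)) = (\<Sum>i\<in>{j}. A i k (q i))"
    by (rule sum.mono_neutral_right) (use q(3) j in auto)
  finally show ?thesis using q(2) by simp
qed

end

section \<open>The vacuum is reached from every nonzero vector\<close>

definition vars_below :: "nat \<Rightarrow> pol \<Rightarrow> bool" where
  "vars_below l p \<longleftrightarrow> (\<forall>M\<in>Poly_Mapping.keys p. \<forall>v\<in>#M. fst v < l)"

lemma keys_partial:
  assumes "M \<in> Poly_Mapping.keys (partial v p)"
  shows "add_mset v M \<in> Poly_Mapping.keys p"
  using assms by (auto simp: in_keys_iff lookup_partial)

context truncated_eigenvalues
begin

text \<open>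
  The derivatives are combinations of \<open>e\<^sub>i(n)\<close> with \<open>n > 0\<close> and scalars, so they preserve \<open>S\<close>, and they lower
  the degree until a nonzero constant is left.
\<close>

lemma one_in_invariant_subspace:
  assumes S: "pol_subspace S" and modes: "\<And>i n p. i < l \<Longrightarrow> p \<in> S \<Longrightarrow> A i n p \<in> S"
    and p: "p \<in> S" "p \<noteq> 0" "vars_below l p"
  shows "1 \<in> S"
proof -
  obtain n where "\<forall>M\<in>Poly_Mapping.keys p. size M \<le> n"
    using finite_nat_set_iff_bounded_le[of "size ` Poly_Mapping.keys p"] by auto
  with p show ?thesis
  proof (induction n arbitrary: p rule: less_induct)
    case (less n)
    show ?case
    proof (cases "\<exists>M\<in>Poly_Mapping.keys p. M \<noteq> {#}")
      case True
      then obtain M i k where M: "M \<in> Poly_Mapping.keys p" "(i, k) \<in># M" by fastforce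
      let ?q = "partial (i, k) p"
      have i: "i < l" using M less.prems(3) by (force simp: vars_below_def)
      have index: "nat (int (Suc k) - 1) = k" by simp
      have "cst (1 / of_nat (Suc k)) * (A i (int (Suc k)) p - cst (mu i (Suc k)) * p) \<in> S"
        by (intro pol_subspaceD(3,4)[OF S] modes i less.prems(1))
      also have "cst (1 / of_nat (Suc k)) * (A i (int (Suc k)) p - cst (mu i (Suc k)) * p) = ?q"
        using index by (simp add: mode_op_def flip: mult.assoc cst_simps(4) of_nat_Suc del: of_nat_Suc cst_simps(4))
      finally have q: "?q \<in> S" .
      obtain M' where M': "M = add_mset (i, k) M'" using M(2) by (metis insert_DiffM)
      hence "Poly_Mapping.lookup ?q M' \<noteq> 0"
        using M(1) by (simp add: lookup_partial in_keys_iff del: of_nat_Suc)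
      hence ne: "?q \<noteq> 0" by auto
      have "size M \<le> n" using less.prems(4) M(1) by blast
      hence n: "n - 1 < n" using M' by auto
      have below: "vars_below l ?q"
        using less.prems(3) keys_partial[of _ "(i, k)" p] unfolding vars_below_def by fastforce
      have "size K \<le> n - 1" if "K \<in> Poly_Mapping.keys ?q" for K
        using keys_partial[OF that] less.prems(4) by fastforce
      with less.IH[OF n q ne below] show ?thesis by blast
    next
      case False
      define c where "c = Poly_Mapping.lookup p 0"
      have "p = cst c"
      proof (rule poly_mapping_eqI)
        fix M
        show "Poly_Mapping.lookup p M = Poly_Mapping.lookup (cst c) M"
          using False by (cases "M = {#}") (auto simp: cst_def c_def lookup_single in_keys_iff)
      qed
      moreover from this have "c \<noteq> 0" using less.prems(2) by auto
      ultimately have "cst (1 / c) * p = 1"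
        by (simp flip: cst_simps(4))
      with pol_subspaceD(3)[OF S less.prems(1)] show ?thesis by metis
    qed
  qed
qed

end

section \<open>The free algebra acting on polynomials\<close>

lemma lin_ext_map:
  assumes "\<And>k. h k 0 = 0" "f 0 = 0"
  shows "lin_ext h (Poly_Mapping.map f p) = lin_ext (\<lambda>k a. h k (f a)) p"
proof -
  have "lin_ext h (Poly_Mapping.map f p) =
      (\<Sum>k\<in>Poly_Mapping.keys p. h k (Poly_Mapping.lookup (Poly_Mapping.map f p) k))"
    by (rule lin_ext_superset)
      (use assms in \<open>auto simp: in_keys_iff map.rep_eq when_def split: if_splits\<close>)
  also have "\<dots> = lin_ext (\<lambda>k a. h k (f a)) p"
    unfolding lin_ext_def by (rule sum.cong) (simp_all add: map.rep_eq in_keys_iff)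
  finally show ?thesis .
qed

lemma left_ideal_hull: "left_ideal (left_ideal hull X)"
  by (rule hull_in) (auto simp: left_ideal_def)

lemma two_sided_ideal_hull: "two_sided_ideal (two_sided_ideal hull X)"
  by (rule hull_in) (auto simp: two_sided_ideal_def left_ideal_def)

lemma left_idealD:
  assumes "left_ideal I"
  shows "0 \<in> I" "x \<in> I \<Longrightarrow> y \<in> I \<Longrightarrow> x + y \<in> I" "x \<in> I \<Longrightarrow> a * x \<in> I"
    "x \<in> I \<Longrightarrow> y \<in> I \<Longrightarrow> x - y \<in> I"
proof -
  show I: "0 \<in> I" "x \<in> I \<Longrightarrow> y \<in> I \<Longrightarrow> x + y \<in> I" "x \<in> I \<Longrightarrow> a * x \<in> I" for x y a
    using assms by (auto simp: left_ideal_def)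
  show "x \<in> I \<Longrightarrow> y \<in> I \<Longrightarrow> x - y \<in> I"
    using I(2)[of x "(- 1) * y"] I(3)[of y "- 1"] by simp
qed

lemma scal_simps [simp]: "scal 0 = 0" "scal 1 = 1" "scal (a + b) = scal a + scal b"
  "scal (a * b) = scal a * scal b"
  by (simp_all add: scal_def single_add mult_single)

lemma scal_commute: "scal c * f = f * scal c"
  by (induction f rule: poly_mapping_additive_induct)
    (simp_all add: scal_def mult_single distrib_left distrib_right mult.commute)

lemma prod_list_letters: "prod_list (map letter xs) = Poly_Mapping.single (Fword xs) 1"
proof (induction xs)
  case Nil
  show ?case by (simp flip: zero_fword_def)
next
  case (Cons x xs)
  then show ?case by (simp add: letter_def mult_single plus_fword_def)
qed

lemma single_fword: "Poly_Mapping.single w c = scal c * prod_list (map letter (letters w))"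
  by (simp add: prod_list_letters scal_def mult_single)

lemma uea_ideal_subset:
  assumes "two_sided_ideal I" "\<And>x y. letter (x + y) - letter x - letter y \<in> I"
    "\<And>c x. letter (sc c x) - scal c * letter x \<in> I"
    "\<And>x y. letter x * letter y - letter y * letter x - letter (br x y) \<in> I"
  shows "uea_ideal sc br \<subseteq> I"
  unfolding uea_ideal_def
proof (rule hull_minimal)
  show "{letter (x + y) - letter x - letter y | x y. True} \<union> {letter (sc c x) - scal c * letter x | c x. True} \<union>
      {letter x * letter y - letter y * letter x - letter (br x y) | x y. True} \<subseteq> I"
    using assms(2-4) by blast
qed (rule assms(1))

locale heisenberg = vector_space scl
  for scl :: "complex \<Rightarrow> 'h::ab_group_add \<Rightarrow> 'h" +
  fixes form :: "'h \<Rightarrow> 'h \<Rightarrow> complex" and l :: nat and e :: "nat \<Rightarrow> 'h"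
  assumes nondegenerate: "nondegenerate_symmetric_form scl form"
    and orthonormal: "orthonormal_basis scl form l e"
begin

lemma form_linear: "Vector_Spaces.linear scl (*) (form a)"
  using nondegenerate by (simp add: nondegenerate_symmetric_form_def)

lemma form_sym: "form a b = form b a"
  using nondegenerate by (auto simp: nondegenerate_symmetric_form_def)

lemma form_simps [simp]:
  "form a (b + c) = form a b + form a c" "form (b + c) a = form b a + form c a"
  "form a (scl r b) = r * form a b" "form (scl r b) a = r * form b a"
  "form a 0 = 0" "form 0 a = 0" "form a (b - c) = form a b - form a c" "form (b - c) a = form b a - form c a"
proof -
  interpret f: Vector_Spaces.linear scl "(*)" "form a" for a by (rule form_linear)
  show "form a (b + c) = form a b + form a c" "form a (scl r b) = r * form a b" "form a 0 = 0"
     "form a (b - c) = form a b - form a c" by (rule f.add f.scale f.zero f.diff)+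
  thus "form (b + c) a = form b a + form c a" "form (scl r b) a = r * form b a" "form 0 a = 0"
    "form (b - c) a = form b a - form c a" by (simp_all add: form_sym[of _ a])
qed

lemma form_sum [simp]: "form a (sum g A) = (\<Sum>x\<in>A. form a (g x))" "form (sum g A) a = (\<Sum>x\<in>A. form (g x) a)"
  by (induction A rule: infinite_finite_induct) simp_all

lemma form_basis: "i < l \<Longrightarrow> j < l \<Longrightarrow> form (e i) (e j) = (if i = j then 1 else 0)"
  using orthonormal by (simp add: orthonormal_basis_def)

lemma basis_expansion: "a = (\<Sum>i<l. scl (form a (e i)) (e i))"
proof -
  define b where "b = a - (\<Sum>i<l. scl (form a (e i)) (e i))"
  have be: "form b (e j) = 0" if "j < l" for j
  proof -
    have "(\<Sum>i<l. form a (e i) * form (e i) (e j)) = (\<Sum>i<l. if i = j then form a (e i) else 0)"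
      using that by (intro sum.cong) (auto simp: form_basis)
    with that show ?thesis by (simp add: b_def)
  qed
  have "form b c = 0" for c
  proof -
    have "c \<in> span (e ` {..<l})" using orthonormal by (simp add: orthonormal_basis_def)
    thus ?thesis by (induction rule: span_induct_alt) (auto simp: be)
  qed
  hence "b = 0" using nondegenerate by (auto simp: nondegenerate_symmetric_form_def)
  thus ?thesis by (simp add: b_def)
qed

lemma form_expansion: "form a b = (\<Sum>i<l. form a (e i) * form b (e i))"
  by (subst basis_expansion[of b]) (simp add: mult.commute)

definition letter_op :: "(nat \<Rightarrow> nat \<Rightarrow> complex) \<Rightarrow> 'h heis \<Rightarrow> pol \<Rightarrow> pol" where
  "letter_op mu x p = cst (snd x) * p +
     lin_ext (\<lambda>n a. \<Sum>i<l. cst (form a (e i)) * mode_op mu i n p) (fst x)"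

definition act :: "(nat \<Rightarrow> nat \<Rightarrow> complex) \<Rightarrow> 'h heis free_alg \<Rightarrow> pol \<Rightarrow> pol" where
  "act mu f p = lin_ext (\<lambda>w c. cst c * foldr (letter_op mu) (letters w) p) f"

lemma letter_op_add: "letter_op mu (x + y) p = letter_op mu x p + letter_op mu y p"
  unfolding letter_op_def fst_add snd_add
  by (subst lin_ext_add) (simp_all add: distrib_right sum.distrib)

lemma letter_op_scale: "letter_op mu (heis_scale scl c x) p = cst c * letter_op mu x p"
proof -
  have "lin_ext (\<lambda>n a. \<Sum>i<l. cst (form a (e i)) * mode_op mu i n p) (Poly_Mapping.map (scl c) (fst x)) =
      cst c * lin_ext (\<lambda>n a. \<Sum>i<l. cst (form a (e i)) * mode_op mu i n p) (fst x)"
    by (subst lin_ext_map) (simp_all add: lin_ext_def sum_distrib_left mult.assoc)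
  thus ?thesis by (simp add: letter_op_def heis_scale_def distrib_left mult.assoc)
qed

lemma letter_op_linear [simp]:
  "letter_op mu x (p + q) = letter_op mu x p + letter_op mu x q"
  "letter_op mu x (cst c * p) = cst c * letter_op mu x p"
  "letter_op mu x 0 = 0"
  by (simp_all add: letter_op_def lin_ext_def distrib_left sum.distrib sum_distrib_left mult.left_commute)

lemma letter_op_mode: "letter_op mu (heis_mode a n) p = (\<Sum>i<l. cst (form a (e i)) * mode_op mu i n p)"
  by (simp add: letter_op_def heis_mode_def lin_ext_single)

lemma letter_op_basis_mode: "i < l \<Longrightarrow> letter_op mu (heis_mode (e i) n) p = mode_op mu i n p"
  by (simp add: letter_op_mode form_basis if_distrib[of cst] if_distrib[of "\<lambda>x. x * _"] sum.delta cong: if_cong)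

lemma letter_op_central: "letter_op mu (0, c) p = cst c * p"
  by (simp add: letter_op_def)

lemma letter_op_zero: "letter_op mu 0 p = 0"
  by (simp add: letter_op_def)

lemma letter_op_induct [case_names central mode add]:
  assumes "\<And>c. P (0, c)" "\<And>a n. P (heis_mode a n)" "\<And>x y. P x \<Longrightarrow> P y \<Longrightarrow> P (x + y)"
  shows "P (x :: 'h heis)"
proof -
  have "P (q, 0)" for q
  proof (induction q rule: poly_mapping_additive_induct)
    case (add p q)
    from assms(3)[OF add] show ?case by simp
  qed (use assms(1,2) in \<open>auto simp: heis_mode_def\<close>)
  from assms(3)[OF this[of "fst x"] assms(1)[of "snd x"]] show ?thesis by simp
qed

lemma bracket_eq: "heis_bracket form x y =
    (0, lin_ext (\<lambda>m a. of_int m * form a (Poly_Mapping.lookup (fst y) (- m))) (fst x))"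
  by (simp add: heis_bracket_def lin_ext_def)

lemma bracket_add: "heis_bracket form (x + x') y = heis_bracket form x y + heis_bracket form x' y"
    "heis_bracket form x (y + y') = heis_bracket form x y + heis_bracket form x y'"
  by (simp add: bracket_eq lin_ext_add distrib_left)
     (simp add: bracket_eq lookup_add distrib_left lin_ext_fun_add)

lemma bracket_mode:
  "heis_bracket form (heis_mode a m) (heis_mode b n) = (0, if m + n = 0 then of_int m * form a b else 0)"
  by (auto simp: bracket_eq heis_mode_def lin_ext_single lookup_single when_def)

text \<open>
  Both sides are biadditive in \<open>x\<close> and \<open>y\<close>, which reduces the claim to central elements and modes; for
  modes it is \<open>mode_op_commutator\<close> expanded in the orthonormal basis.
\<close>

lemma letter_op_bracket:
  "letter_op mu x (letter_op mu y p) - letter_op mu y (letter_op mu x p) =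
     letter_op mu (heis_bracket form x y) p"
proof -
  have eq: "letter_op mu x (letter_op mu y p) =
      letter_op mu y (letter_op mu x p) + letter_op mu (heis_bracket form x y) p"
  proof (induction x rule: letter_op_induct)
    case (central c)
    have "heis_bracket form (0, c) y = 0" by (simp add: bracket_eq zero_prod_def)
    then show ?case by (simp add: letter_op_central letter_op_zero)
  next
    case (add x x')
    then show ?case by (simp add: letter_op_add bracket_add)
  next
    case (mode a m)
    show ?case
    proof (induction y rule: letter_op_induct)
      case (central c)
      have "heis_bracket form (heis_mode a m) (0, c) = 0"
        by (simp add: bracket_eq zero_prod_def lin_ext_def)
      then show ?case by (simp add: letter_op_central letter_op_zero)
    next
      case (add y y')
      then show ?case by (simp add: letter_op_add bracket_add)
    next
      case (mode b n)
      let ?c = "\<lambda>i. cst (form a (e i))" and ?d = "\<lambda>j. cst (form b (e j))"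
      let ?A = "mode_op mu"
      have "letter_op mu (heis_mode a m) (letter_op mu (heis_mode b n) p) =
          (\<Sum>i<l. \<Sum>j<l. ?c i * (?d j * ?A i m (?A j n p)))"
        by (simp add: letter_op_mode mode_op_sum sum_distrib_left)
      also have "\<dots> = (\<Sum>i<l. \<Sum>j<l. ?c i * (?d j * ?A j n (?A i m p))) +
          (\<Sum>i<l. \<Sum>j<l. ?c i * (?d j * (if i = j \<and> m + n = 0 then cst (of_int m) * p else 0)))"
        by (subst mode_op_commutator) (simp add: distrib_left sum.distrib)
      also have "(\<Sum>i<l. \<Sum>j<l. ?c i * (?d j * ?A j n (?A i m p))) =
          letter_op mu (heis_mode b n) (letter_op mu (heis_mode a m) p)"
        by (subst sum.swap) (simp add: letter_op_mode mode_op_sum sum_distrib_left mult.left_commute)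
      also have "(\<Sum>i<l. \<Sum>j<l. ?c i * (?d j * (if i = j \<and> m + n = 0 then cst (of_int m) * p else 0))) =
          (\<Sum>i<l. \<Sum>j<l. if i = j then ?c i * (?d i * (if m + n = 0 then cst (of_int m) * p else 0)) else 0)"
        by (intro sum.cong refl) auto
      also have "\<dots> = (\<Sum>i<l. ?c i * (?d i * (if m + n = 0 then cst (of_int m) * p else 0)))"
        by (simp add: sum.delta)
      also have "\<dots> = letter_op mu (heis_bracket form (heis_mode a m) (heis_mode b n)) p"
        by (simp add: bracket_mode letter_op_central form_expansion[of a b] cst_sum sum_distrib_left
            sum_distrib_right mult_ac)
      finally show ?case .
    qed
  qed
  thus ?thesis by simp
qed

lemma foldr_letter_op_linear:
  "foldr (letter_op mu) xs (p + q) = foldr (letter_op mu) xs p + foldr (letter_op mu) xs q"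
  "foldr (letter_op mu) xs (cst c * p) = cst c * foldr (letter_op mu) xs p"
  "foldr (letter_op mu) xs 0 = 0"
  by (induction xs) simp_all

lemma act_linear [simp]:
  "act mu f (p + q) = act mu f p + act mu f q"
  "act mu f (cst c * p) = cst c * act mu f p"
  "act mu f 0 = 0"
  by (simp_all add: act_def lin_ext_def foldr_letter_op_linear distrib_left sum.distrib
      sum_distrib_left mult.left_commute)

lemma act_add [simp]: "act mu (f + g) p = act mu f p + act mu g p"
  unfolding act_def by (rule lin_ext_add) (simp_all add: distrib_right)

lemma act_zero [simp]: "act mu 0 p = 0"
  by (simp add: act_def)

lemma act_diff [simp]: "act mu (f - g) p = act mu f p - act mu g p"
  using act_add[of mu "f - g" g p] by simp

lemma act_single: "act mu (Poly_Mapping.single w c) p = cst c * foldr (letter_op mu) (letters w) p"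
  unfolding act_def by (rule lin_ext_single) simp

lemma act_letter [simp]: "act mu (letter x) p = letter_op mu x p"
  by (simp add: letter_def act_single)

lemma act_scal [simp]: "act mu (scal c) p = cst c * p"
  by (simp add: scal_def act_single zero_fword_def)

lemma act_one [simp]: "act mu 1 p = p"
  using act_scal[of mu 1 p] by simp

lemma act_mult [simp]: "act mu (f * g) p = act mu f (act mu g p)"
proof (induction f rule: poly_mapping_additive_induct)
  case (single w c)
  show ?case
    by (induction g rule: poly_mapping_additive_induct)
      (simp_all add: mult_single act_single plus_fword_def foldr_letter_op_linear distrib_left mult.assoc)
qed (simp_all add: distrib_right)

lemma act_uea_ideal:
  assumes "f \<in> uea_ideal (heis_scale scl) (heis_bracket form)"
  shows "act mu f p = 0"
proof -
  have "uea_ideal (heis_scale scl) (heis_bracket form) \<subseteq> {f. \<forall>p. act mu f p = 0}"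
  proof (rule uea_ideal_subset)
    show "two_sided_ideal {f :: 'h heis free_alg. \<forall>p. act mu f p = 0}"
      by (simp add: two_sided_ideal_def left_ideal_def)
  qed (simp_all only: mem_Collect_eq act_diff act_mult act_letter act_scal letter_op_add
      letter_op_scale letter_op_bracket add_diff_cancel_left' diff_self HOL.simp_thms)
  with assms show ?thesis by blast
qed

end

section \<open>The Whittaker ideal is the annihilator of the vacuum polynomial\<close>

lemma prod_var: "prod_list (map var vs) = Poly_Mapping.single (mset vs) 1"
  by (induction vs) (simp_all add: var_def mult_single)

lemma vars_below_simps:
  "vars_below l 0" "vars_below l p \<Longrightarrow> vars_below l q \<Longrightarrow> vars_below l (p + q)"
  "vars_below l p \<Longrightarrow> vars_below l (cst c * p)"
  using Poly_Mapping.keys_add[of p q]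
  by (auto simp: vars_below_def in_keys_iff cst_mult_lookup)

lemma vars_below_one: "vars_below l 1"
  by (simp add: vars_below_def)

lemma vars_below_sum: "(\<And>x. x \<in> X \<Longrightarrow> vars_below l (g x)) \<Longrightarrow> vars_below l (sum g X)"
  by (induction X rule: infinite_finite_induct) (simp_all add: vars_below_simps)

lemma vars_below_mode_op:
  assumes "i < l" "vars_below l p"
  shows "vars_below l (mode_op mu i n p)"
proof -
  have "vars_below l (var (i, k) * p)" for k
    using assms Poly_Mapping.keys_mult[of "var (i, k)" p]
    by (fastforce simp: vars_below_def var_def)
  moreover have "vars_below l (partial v p)" for v
    using assms keys_partial[of _ v p] by (fastforce simp: vars_below_def)
  ultimately show ?thesis using assms(2) by (simp add: mode_op_def vars_below_simps)
qed

definition (in heisenberg) heis_word :: "(nat \<times> nat) list \<Rightarrow> 'h heis free_alg" where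
  "heis_word vs = prod_list (map (\<lambda>(i, k). letter (heis_mode (e i) (- int k - 1))) vs)"

definition (in heisenberg) normal_form :: "pol \<Rightarrow> 'h heis free_alg" where
  "normal_form = lin_ext (\<lambda>M c. scal c * heis_word (sorted_list_of_multiset M))"

locale whittaker = heisenberg +
  fixes lam
  assumes whittaker: "whittaker_function scl lam"
begin

text \<open>
  Indices \<open>i \<ge> l\<close> belong to no basis vector; the value \<open>0\<close> there makes the eigenvalues vanish beyond
  a bound that is uniform in \<open>i\<close>.
\<close>

definition mu :: "nat \<Rightarrow> nat \<Rightarrow> complex" where
  "mu i n = (if i < l then lam (Poly_Mapping.single n (e i)) else 0)"

abbreviation U where "U \<equiv> uea_ideal (heis_scale scl) (heis_bracket form)"
abbreviation L where "L \<equiv> whittaker_ideal scl form lam"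
abbreviation vacuum_image where "vacuum_image f \<equiv> act mu f 1"

lemma lam_linear: "lam (x + y) = lam x + lam y" "lam (Poly_Mapping.map (scl c) x) = c * lam x" "lam 0 = 0"
proof -
  have lin: "Vector_Spaces.linear (\<lambda>c. Poly_Mapping.map (scl c)) (*) lam"
    using whittaker by (simp add: whittaker_function_def)
  interpret lam: Vector_Spaces.linear "\<lambda>c. Poly_Mapping.map (scl c)" "(*)" lam by (rule lin)
  show "lam (x + y) = lam x + lam y" "lam (Poly_Mapping.map (scl c) x) = c * lam x" "lam 0 = 0"
    by (rule lam.add lam.scale lam.zero)+
qed

lemma lam_expansion: "lam x = lin_ext (\<lambda>n a. \<Sum>i<l. form a (e i) * mu i n) x"
proof (induction x rule: poly_mapping_additive_induct)
  case zero
  show ?case by (simp add: lam_linear)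
next
  case (add x y)
  then show ?case
    by (subst lin_ext_add) (simp_all add: lam_linear distrib_right sum.distrib)
next
  case (single n a)
  have 1: "lam (\<Sum>i\<in>I. Poly_Mapping.single n (g i)) = (\<Sum>i\<in>I. lam (Poly_Mapping.single n (g i)))" for I :: "nat set" and g
    by (induction I rule: infinite_finite_induct) (simp_all add: lam_linear)
  have 2: "Poly_Mapping.single n (sum g I) = (\<Sum>i\<in>I. Poly_Mapping.single n (g i))" for I :: "nat set" and g
    by (induction I rule: infinite_finite_induct) (simp_all add: single_add)
  have "lam (Poly_Mapping.single n a) = (\<Sum>i<l. lam (Poly_Mapping.single n (scl (form a (e i)) (e i))))"
    by (subst basis_expansion[of a]) (simp only: 1 2)
  also have "\<dots> = (\<Sum>i<l. form a (e i) * mu i n)"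
  proof (rule sum.cong[OF refl])
    fix i assume i: "i \<in> {..<l}"
    have "lam (Poly_Mapping.single n (scl c b)) = c * lam (Poly_Mapping.single n b)" for c b
      using lam_linear(2)[of c "Poly_Mapping.single n b"] by simp
    with i show "lam (Poly_Mapping.single n (scl (form a (e i)) (e i))) = form a (e i) * mu i n"
      by (simp add: lam_linear mu_def)
  qed
  finally show ?case by (simp add: lin_ext_single)
qed

text \<open>
  All derivatives of \<open>1\<close> vanish, so a nonnegative mode acts on \<open>1\<close> by its eigenvalue.
\<close>

lemma letter_op_character:
  assumes "x \<in> heis_nonneg"
  shows "letter_op mu x 1 = cst (whittaker_character lam x)"
proof -
  let ?q = "fst x"
  have keys: "Poly_Mapping.keys ?q \<subseteq> {0..}" using assms by (simp add: heis_nonneg_def)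
  have "lin_ext (\<lambda>n a. \<Sum>i<l. cst (form a (e i)) * mode_op mu i n 1) ?q =
      cst (lin_ext (\<lambda>n a. \<Sum>i<l. form a (e i) * mu i (nat n)) ?q)"
    unfolding lin_ext_def cst_sum
  proof (rule sum.cong[OF refl])
    fix n assume "n \<in> Poly_Mapping.keys ?q"
    with keys have "n \<ge> 0" by auto
    thus "(\<Sum>i<l. cst (form (Poly_Mapping.lookup ?q n) (e i)) * mode_op mu i n 1) =
        (\<Sum>i<l. cst (form (Poly_Mapping.lookup ?q n) (e i) * mu i (nat n)))"
      using partial_cst[of _ 1] by (simp add: mode_op_def)
  qed
  also have "lin_ext (\<lambda>n a. \<Sum>i<l. form a (e i) * mu i (nat n)) ?q = lam (Poly_Mapping.map_key int ?q)"
  proof -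
    have inj: "inj int" by simp
    have "\<exists>k. n = int k" if "n \<in> Poly_Mapping.keys ?q" for n
      using that keys zero_le_imp_eq_int[of n] by auto
    hence keys_eq: "Poly_Mapping.keys ?q = int ` Poly_Mapping.keys (Poly_Mapping.map_key int ?q)"
      by (force simp: keys_map_key[OF inj])
    have lookup_eq: "Poly_Mapping.lookup (Poly_Mapping.map_key int ?q) n = Poly_Mapping.lookup ?q (int n)" for n
      by (simp add: map_key.rep_eq[OF inj])
    let ?G = "\<lambda>n. \<Sum>i<l. form (Poly_Mapping.lookup ?q (int n)) (e i) * mu i n"
    have "lin_ext (\<lambda>n a. \<Sum>i<l. form a (e i) * mu i (nat n)) ?q =
        (\<Sum>n\<in>int ` Poly_Mapping.keys (Poly_Mapping.map_key int ?q). ?G (nat n))"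
      unfolding lin_ext_def by (rule sum.cong[OF keys_eq]) (use keys_eq in auto)
    also have "\<dots> = sum ?G (Poly_Mapping.keys (Poly_Mapping.map_key int ?q))"
      by (subst sum.reindex) simp_all
    also have "\<dots> = lam (Poly_Mapping.map_key int ?q)"
      using lam_expansion[of "Poly_Mapping.map_key int ?q"] by (simp only: lin_ext_def lookup_eq)
    finally show ?thesis .
  qed
  finally show ?thesis by (simp add: letter_op_def whittaker_character_def add.commute)
qed

lemma L_left_ideal: "left_ideal L"
  unfolding whittaker_ideal_def induced_left_ideal_def by (rule left_ideal_hull)

lemma U_subset_L: "U \<subseteq> L"
  unfolding whittaker_ideal_def induced_left_ideal_def
  using hull_subset[of "U \<union> {letter x - scal (whittaker_character lam x) |x. x \<in> heis_nonneg}" left_ideal] by blast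

lemma character_in_L: "x \<in> heis_nonneg \<Longrightarrow> letter x - scal (whittaker_character lam x) \<in> L"
  unfolding whittaker_ideal_def induced_left_ideal_def
  by (rule subsetD[OF hull_subset]) blast

lemma vacuum_image_L:
  assumes "f \<in> L"
  shows "vacuum_image f = 0"
proof -
  have "L \<subseteq> {f. vacuum_image f = 0}"
    unfolding whittaker_ideal_def induced_left_ideal_def
  proof (rule hull_minimal)
    show "left_ideal {f. vacuum_image f = 0}" by (simp add: left_ideal_def)
  qed (auto simp: act_uea_ideal letter_op_character)
  with assms show ?thesis by blast
qed

lemma U_two_sided: "two_sided_ideal U"
  unfolding uea_ideal_def by (rule two_sided_ideal_hull)

lemma U_gens:
  "letter (x + y) - letter x - letter y \<in> U"
  "letter (heis_scale scl c x) - scal c * letter x \<in> U"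
  "letter x * letter y - letter y * letter x - letter (heis_bracket form x y) \<in> U"
proof -
  show "letter (x + y) - letter x - letter y \<in> U"
    "letter (heis_scale scl c x) - scal c * letter x \<in> U"
    "letter x * letter y - letter y * letter x - letter (heis_bracket form x y) \<in> U"
    unfolding uea_ideal_def by (rule subsetD[OF hull_subset], blast)+
qed

lemma U_mult: "f \<in> U \<Longrightarrow> f * g \<in> U"
  using U_two_sided by (simp add: two_sided_ideal_def)

lemma letter_zero_in_U: "letter 0 \<in> U"
proof -
  have "heis_scale scl 0 0 = (0 :: 'a heis)"
    by (simp add: heis_scale_def zero_prod_def map_eq_zero_iff)
  with U_gens(2)[of 0 0] show ?thesis by simp
qed

lemma bracket_negative_modes:
  assumes "m < 0" "n < 0"
  shows "heis_bracket form (heis_mode a m) (heis_mode b n) = 0"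
  using assms by (simp add: bracket_mode zero_prod_def)

lemma heis_word_Cons: "heis_word ((i, k) # vs) = letter (heis_mode (e i) (- int k - 1)) * heis_word vs"
  by (simp add: heis_word_def)

lemma U_left: "left_ideal U"
  using U_two_sided by (simp add: two_sided_ideal_def)

text \<open>
  Negative modes commute up to \<open>letter 0\<close>, which lies in the ideal.
\<close>

lemma heis_word_insort: "heis_word (v # vs) - heis_word (insort v vs) \<in> U"
proof (induction vs)
  case Nil
  show ?case using left_idealD(1)[OF U_left] by simp
next
  case (Cons u vs)
  show ?case
  proof (cases "v \<le> u")
    case True
    thus ?thesis using left_idealD(1)[OF U_left] by simp
  next
    case False
    obtain i k where v: "v = (i, k)" by (cases v)
    obtain j m where u: "u = (j, m)" by (cases u)
    let ?x = "letter (heis_mode (e i) (- int k - 1))" and ?y = "letter (heis_mode (e j) (- int m - 1))"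
    have "?x * ?y - ?y * ?x - letter 0 \<in> U"
      using U_gens(3)[of "heis_mode (e i) (- int k - 1)" "heis_mode (e j) (- int m - 1)"]
      by (simp add: bracket_negative_modes)
    from left_idealD(2)[OF U_left this letter_zero_in_U] have "?x * ?y - ?y * ?x \<in> U" by simp
    from U_mult[OF this, of "heis_word vs"] left_idealD(3)[OF U_left Cons.IH, of ?y]
    have "(?x * ?y - ?y * ?x) * heis_word vs + ?y * (heis_word (v # vs) - heis_word (insort v vs)) \<in> U"
      by (rule left_idealD(2)[OF U_left])
    moreover have "(?x * ?y - ?y * ?x) * heis_word vs + ?y * (heis_word (v # vs) - heis_word (insort v vs)) =
        heis_word (v # u # vs) - heis_word (u # insort v vs)"
      by (simp add: u v heis_word_Cons algebra_simps)
    ultimately show ?thesis using False by simp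
  qed
qed

lemma heis_word_sort: "heis_word vs - heis_word (sort vs) \<in> U"
proof (induction vs)
  case Nil
  show ?case using left_idealD(1)[OF U_left] by simp
next
  case (Cons v vs)
  obtain i k where v: "v = (i, k)" by (cases v)
  have "letter (heis_mode (e i) (- int k - 1)) * (heis_word vs - heis_word (sort vs)) \<in> U"
    by (rule left_idealD(3)[OF U_left Cons])
  hence "heis_word (v # vs) - heis_word (v # sort vs) \<in> U"
    by (simp add: v heis_word_Cons right_diff_distrib)
  from left_idealD(2)[OF U_left this heis_word_insort[of v "sort vs"]] show ?case by simp
qed

lemma act_heis_word: "\<forall>v\<in>set vs. fst v < l \<Longrightarrow> act m (heis_word vs) p = prod_list (map var vs) * p"
proof (induction vs)
  case Nil
  show ?case by (simp add: heis_word_def)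
next
  case (Cons v vs)
  then show ?case
    by (cases v) (simp add: heis_word_Cons letter_op_basis_mode mode_op_def mult.assoc)
qed

lemma vars_below_letter_op: "vars_below l p \<Longrightarrow> vars_below l (letter_op m x p)"
  unfolding letter_op_def lin_ext_def
  by (intro vars_below_simps vars_below_sum vars_below_mode_op) auto

lemma vars_below_act: "vars_below l p \<Longrightarrow> vars_below l (act m f p)"
proof -
  assume p: "vars_below l p"
  have "vars_below l (foldr (letter_op m) xs p)" for xs
    by (induction xs) (simp_all add: p vars_below_letter_op)
  thus ?thesis unfolding act_def lin_ext_def by (intro vars_below_sum vars_below_simps)
qed

lemma normal_form_add: "normal_form (p + q) = normal_form p + normal_form q"
  unfolding normal_form_def by (rule lin_ext_add) (simp_all add: distrib_right)

lemma normal_form_zero: "normal_form 0 = 0"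
  by (simp add: normal_form_def)

lemma normal_form_single: "normal_form (Poly_Mapping.single M c) = scal c * heis_word (sorted_list_of_multiset M)"
  unfolding normal_form_def by (rule lin_ext_single) simp

lemma normal_form_scale: "normal_form (cst c * p) = scal c * normal_form p"
proof (induction p rule: poly_mapping_additive_induct)
  case (single M a)
  have "cst c * Poly_Mapping.single M a = Poly_Mapping.single M (c * a)"
    by (simp add: cst_def mult_single)
  then show ?case by (simp add: normal_form_single mult.assoc)
qed (simp_all add: normal_form_zero normal_form_add distrib_left)

text \<open>
  The elements that are congruent to their normal form. That every element is of this kind is the
  spanning half of the Poincare-Birkhoff-Witt theorem for the induced module; it turns the
  inclusion of \<open>L\<close> in the annihilator of \<open>1\<close> into an equality.
\<close>

definition normalizable :: "'a heis free_alg set" where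
  "normalizable = {f. f - normal_form (vacuum_image f) \<in> L}"

lemma normalizable_add: "f \<in> normalizable \<Longrightarrow> g \<in> normalizable \<Longrightarrow> f + g \<in> normalizable"
  using left_idealD(2)[OF L_left_ideal, of "f - normal_form (vacuum_image f)" "g - normal_form (vacuum_image g)"]
  by (simp add: normalizable_def normal_form_add algebra_simps)

lemma normalizable_scale: "f \<in> normalizable \<Longrightarrow> scal c * f \<in> normalizable"
  using left_idealD(3)[OF L_left_ideal, of "f - normal_form (vacuum_image f)" "scal c"]
  by (simp add: normalizable_def normal_form_scale right_diff_distrib)

lemma L_subset_normalizable: "f \<in> L \<Longrightarrow> f \<in> normalizable"
  by (simp add: normalizable_def vacuum_image_L normal_form_zero)

lemma normalizable_cong: "f - g \<in> L \<Longrightarrow> g \<in> normalizable \<Longrightarrow> f \<in> normalizable"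
  using normalizable_add[OF L_subset_normalizable, of "f - g" g] by simp

lemma normalizable_sum: "(\<And>x. x \<in> X \<Longrightarrow> g x \<in> normalizable) \<Longrightarrow> sum g X \<in> normalizable"
  by (induction X rule: infinite_finite_induct)
    (simp_all add: normalizable_add L_subset_normalizable left_idealD(1)[OF L_left_ideal])

lemma heis_word_normalizable:
  assumes "\<forall>v\<in>set vs. fst v < l"
  shows "heis_word vs \<in> normalizable"
proof -
  have "normal_form (vacuum_image (heis_word vs)) = heis_word (sort vs)"
    by (simp add: act_heis_word[OF assms] prod_var normal_form_single)
  with heis_word_sort[of vs] U_subset_L show ?thesis by (auto simp: normalizable_def)
qed

text \<open>
  These letters form a subspace, which reduces the spanning statement to basis modes and central
  elements.
\<close>

definition stable_letters :: "'a heis set" where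
  "stable_letters = {x. \<forall>f\<in>normalizable. letter x * f \<in> normalizable}"

lemma stable_letters_add:
  assumes "x \<in> stable_letters" "y \<in> stable_letters"
  shows "x + y \<in> stable_letters"
  unfolding stable_letters_def
proof (intro CollectI ballI)
  fix f assume f: "f \<in> normalizable"
  have "letter (x + y) * f - (letter x * f + letter y * f) \<in> L"
    using U_mult[OF U_gens(1)[of x y], of f] U_subset_L by (auto simp: algebra_simps)
  moreover have "letter x * f + letter y * f \<in> normalizable"
    using assms f by (auto simp: stable_letters_def intro!: normalizable_add)
  ultimately show "letter (x + y) * f \<in> normalizable" by (rule normalizable_cong)
qed

lemma stable_letters_scale:
  assumes "x \<in> stable_letters"
  shows "heis_scale scl c x \<in> stable_letters"
  unfolding stable_letters_def
proof (intro CollectI ballI)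
  fix f assume f: "f \<in> normalizable"
  have "letter (heis_scale scl c x) * f - scal c * (letter x * f) \<in> L"
    using U_mult[OF U_gens(2)[of c x], of f] U_subset_L by (auto simp: algebra_simps)
  moreover have "scal c * (letter x * f) \<in> normalizable"
    using assms f by (auto simp: stable_letters_def intro!: normalizable_scale)
  ultimately show "letter (heis_scale scl c x) * f \<in> normalizable" by (rule normalizable_cong)
qed

lemma stable_lettersI:
  assumes "\<And>vs. \<forall>v\<in>set vs. fst v < l \<Longrightarrow> letter x * heis_word vs \<in> normalizable"
  shows "x \<in> stable_letters"
  unfolding stable_letters_def
proof (intro CollectI ballI)
  fix f assume "f \<in> normalizable"
  hence "letter x * (f - normal_form (vacuum_image f)) \<in> L"
    unfolding normalizable_def using left_idealD(3)[OF L_left_ideal] by blast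
  hence "letter x * f - letter x * normal_form (vacuum_image f) \<in> L"
    by (simp add: right_diff_distrib)
  moreover have "letter x * normal_form (vacuum_image f) \<in> normalizable"
    unfolding normal_form_def lin_ext_def sum_distrib_left
  proof (rule normalizable_sum)
    fix M assume M: "M \<in> Poly_Mapping.keys (vacuum_image f)"
    with vars_below_act[OF vars_below_one, of mu f] have "\<forall>v\<in>set (sorted_list_of_multiset M). fst v < l"
      by (auto simp: vars_below_def)
    from normalizable_scale[OF assms[OF this]]
    show "letter x * (scal (Poly_Mapping.lookup (vacuum_image f) M) * heis_word (sorted_list_of_multiset M)) \<in> normalizable"
      by (metis mult.assoc scal_commute)
  qed
  ultimately show "letter x * f \<in> normalizable" by (rule normalizable_cong)
qed

lemma negative_mode_stable:
  assumes "i < l" "n < 0"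
  shows "heis_mode (e i) n \<in> stable_letters"
proof (rule stable_lettersI)
  fix vs :: "(nat \<times> nat) list" assume "\<forall>v\<in>set vs. fst v < l"
  with assms(1) have "heis_word ((i, nat (- n - 1)) # vs) \<in> normalizable"
    by (intro heis_word_normalizable) auto
  thus "letter (heis_mode (e i) n) * heis_word vs \<in> normalizable"
    using assms(2) by (simp add: heis_word_Cons)
qed

text \<open>
  Move \<open>x\<close> to the right through the word. Each step costs a bracket, and at the right end \<open>x\<close> acts by
  its character.
\<close>

lemma nonneg_stable:
  assumes x: "x \<in> heis_nonneg"
    and bracket: "\<And>i k vs. \<forall>v\<in>set vs. fst v < l \<Longrightarrow>
      letter (heis_bracket form x (heis_mode (e i) (- int k - 1))) * heis_word vs \<in> normalizable"
  shows "x \<in> stable_letters"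
proof (rule stable_lettersI)
  fix vs :: "(nat \<times> nat) list" assume "\<forall>v\<in>set vs. fst v < l"
  thus "letter x * heis_word vs \<in> normalizable"
  proof (induction vs)
    case Nil
    have "letter x - scal (whittaker_character lam x) * heis_word [] \<in> L"
      using character_in_L[OF x] by (simp add: heis_word_def)
    moreover have "scal (whittaker_character lam x) * heis_word [] \<in> normalizable"
      by (intro normalizable_scale heis_word_normalizable) simp
    ultimately show ?case using normalizable_cong by (simp add: heis_word_def)
  next
    case (Cons v vs)
    obtain i k where v: "v = (i, k)" by (cases v)
    let ?y = "heis_mode (e i) (- int k - 1)"
    have "(letter x * letter ?y - letter ?y * letter x - letter (heis_bracket form x ?y)) * heis_word vs \<in> L"
      using U_mult[OF U_gens(3)] U_subset_L by blast
    hence "letter x * heis_word (v # vs) -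
        (letter ?y * (letter x * heis_word vs) + letter (heis_bracket form x ?y) * heis_word vs) \<in> L"
      by (simp add: v heis_word_Cons algebra_simps)
    moreover have "?y \<in> stable_letters" using Cons.prems v by (intro negative_mode_stable) auto
    hence "letter ?y * (letter x * heis_word vs) + letter (heis_bracket form x ?y) * heis_word vs \<in> normalizable"
      using Cons bracket by (intro normalizable_add) (auto simp: stable_letters_def)
    ultimately show ?case by (rule normalizable_cong)
  qed
qed

lemma central_stable: "(0, c) \<in> stable_letters"
proof (rule nonneg_stable)
  show "(0, c) \<in> heis_nonneg" by (simp add: heis_nonneg_def)
  fix i k and vs :: "(nat \<times> nat) list"
  have "heis_bracket form (0, c) (heis_mode (e i) (- int k - 1)) = 0"
    by (simp add: bracket_eq zero_prod_def)
  moreover have "letter 0 * heis_word vs \<in> normalizable"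
    by (intro L_subset_normalizable subsetD[OF U_subset_L] U_mult letter_zero_in_U)
  ultimately show "letter (heis_bracket form (0, c) (heis_mode (e i) (- int k - 1))) * heis_word vs \<in> normalizable"
    by simp
qed

lemma basis_mode_stable:
  assumes "i < l"
  shows "heis_mode (e i) n \<in> stable_letters"
proof (cases "n < 0")
  case False
  show ?thesis
  proof (rule nonneg_stable)
    show "heis_mode (e i) n \<in> heis_nonneg" using False by (simp add: heis_nonneg_def heis_mode_def)
    fix j k and vs :: "(nat \<times> nat) list" assume "\<forall>v\<in>set vs. fst v < l"
    thus "letter (heis_bracket form (heis_mode (e i) n) (heis_mode (e j) (- int k - 1))) * heis_word vs \<in> normalizable"
      using central_stable heis_word_normalizable by (simp add: bracket_mode stable_letters_def)
  qed
qed (use negative_mode_stable assms in simp)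

lemma all_letters_stable: "x \<in> stable_letters"
proof (induction x rule: letter_op_induct)
  case (mode a n)
  have sum: "heis_mode (\<Sum>i\<in>I. scl (g i) (e i)) n \<in> stable_letters" if "I \<subseteq> {..<l}" "finite I" for I g
    using that(2,1)
  proof induction
    case empty
    show ?case using central_stable[of 0] by (simp add: heis_mode_def)
  next
    case (insert i I)
    have "heis_mode (scl (g i) (e i)) n = heis_scale scl (g i) (heis_mode (e i) n)"
      by (simp add: heis_mode_def heis_scale_def)
    with insert stable_letters_scale[OF basis_mode_stable[of i n], of "g i"]
      stable_letters_add[of "heis_mode (scl (g i) (e i)) n" "heis_mode (\<Sum>i\<in>I. scl (g i) (e i)) n"]
    show ?case by (simp add: heis_mode_def single_add)
  qed
  from sum[of "{..<l}" "\<lambda>i. form a (e i)"] show ?case by (simp flip: basis_expansion)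
qed (use central_stable stable_letters_add in auto)

lemma all_normalizable: "f \<in> normalizable"
proof (induction f rule: poly_mapping_additive_induct)
  case (single w c)
  have "prod_list (map letter xs) \<in> normalizable" for xs :: "'a heis list"
  proof (induction xs)
    case Nil
    show ?case using heis_word_normalizable[of "[]"] by (simp add: heis_word_def)
  next
    case (Cons x xs)
    then show ?case using all_letters_stable[of x] by (simp add: stable_letters_def)
  qed
  then show ?case by (simp add: single_fword normalizable_scale)
qed (auto intro: normalizable_add L_subset_normalizable left_idealD(1)[OF L_left_ideal])

theorem whittaker_ideal_eq_kernel: "f \<in> L \<longleftrightarrow> vacuum_image f = 0"
proof
  assume "vacuum_image f = 0"
  with all_normalizable[of f] show "f \<in> L" by (simp add: normalizable_def normal_form_zero)
qed (rule vacuum_image_L)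

end

section \<open>Vertex operators in the polynomial model\<close>

context whittaker
begin

definition coset :: "pol \<Rightarrow> 'a heis free_alg set" where
  "coset p = {f. vacuum_image f = p}"

definition model :: "pol set" where
  "model = range vacuum_image"

lemma coset_eq: "f +o L = coset (vacuum_image f)"
proof (intro set_eqI iffI)
  fix g assume "g \<in> coset (vacuum_image f)"
  hence "g - f \<in> L" by (simp add: whittaker_ideal_eq_kernel coset_def)
  thus "g \<in> f +o L" unfolding elt_set_plus_def by (intro CollectI bexI[of _ "g - f"]) simp_all
qed (auto simp: elt_set_plus_def whittaker_ideal_eq_kernel coset_def)

lemma L_eq_coset: "L = coset 0"
  by (auto simp: coset_def whittaker_ideal_eq_kernel)

lemma module_eq: "whittaker_module scl form lam = coset ` model"
  unfolding whittaker_module_def quotient_carrier_def coset_eq model_def by auto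

lemma coset_inj: "p \<in> model \<Longrightarrow> coset p = coset q \<longleftrightarrow> p = q"
  by (auto simp: coset_def model_def)

lemma zero_in_model: "0 \<in> model"
  unfolding model_def by (rule range_eqI[of _ _ 0]) simp

lemma one_in_model: "1 \<in> model"
  unfolding model_def by (rule range_eqI[of _ _ 1]) simp

lemma add_in_model: "p \<in> model \<Longrightarrow> q \<in> model \<Longrightarrow> p + q \<in> model"
  unfolding model_def by (auto simp flip: act_add)

lemma act_in_model: "p \<in> model \<Longrightarrow> act mu u p \<in> model"
  unfolding model_def by (auto simp flip: act_mult)

lemma scale_in_model: "p \<in> model \<Longrightarrow> cst c * p \<in> model"
  using act_in_model[of p "scal c"] by simp

lemma letter_op_in_model: "p \<in> model \<Longrightarrow> letter_op mu x p \<in> model"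
  using act_in_model[of p "letter x"] by simp

lemma sum_in_model: "(\<And>i. i \<in> I \<Longrightarrow> x i \<in> model) \<Longrightarrow> sum x I \<in> model"
  by (induction I rule: infinite_finite_induct) (simp_all add: zero_in_model add_in_model)

lemma coset_add:
  assumes "p \<in> model" "q \<in> model"
  shows "coset p + coset q = coset (p + q)"
proof (intro set_eqI iffI)
  fix h assume h: "h \<in> coset (p + q)"
  obtain f where f: "vacuum_image f = p" using assms by (auto simp: model_def)
  have "f \<in> coset p" "h - f \<in> coset q" using f h by (simp_all add: coset_def)
  hence "f + (h - f) \<in> coset p + coset q" by (rule set_plus_intro)
  thus "h \<in> coset p + coset q" by simp
qed (auto simp: set_plus_def coset_def)

lemma quotient_act_coset:
  assumes "p \<in> model"
  shows "quotient_act L u (coset p) = coset (act mu u p)"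
proof (intro set_eqI iffI)
  fix h assume h: "h \<in> coset (act mu u p)"
  obtain f where f: "vacuum_image f = p" using assms by (auto simp: model_def)
  have "u * f \<in> u *o coset p" using f by (auto simp: elt_set_times_def coset_def)
  moreover have "h - u * f \<in> L" using f h by (simp add: coset_def whittaker_ideal_eq_kernel)
  ultimately have "u * f + (h - u * f) \<in> u *o coset p + L" by (rule set_plus_intro)
  thus "h \<in> quotient_act L u (coset p)" by (simp add: quotient_act_def)
qed (auto simp: quotient_act_def set_plus_def elt_set_times_def coset_def whittaker_ideal_eq_kernel)

text \<open>
  If infinitely many members are nonzero, both sides are the zero coset, by the default value of
  infinite sums.
\<close>

lemma quotient_sum_coset:
  assumes "\<And>i. i \<in> I \<Longrightarrow> x i \<in> model" "\<And>i. i \<in> I \<Longrightarrow> X i = coset (x i)"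
  shows "quotient_sum L I X = coset (\<Sum>i\<in>{i\<in>I. x i \<noteq> 0}. x i)"
proof -
  have eq: "{i\<in>I. X i \<noteq> L} = {i\<in>I. x i \<noteq> 0}"
    using assms coset_inj[of "x _" 0] by (auto simp: L_eq_coset)
  have "(\<Sum>i\<in>J. X i) + L = coset (\<Sum>i\<in>J. x i)" if "J \<subseteq> I" for J
    using that
  proof (induction J rule: infinite_finite_induct)
    case (insert i J)
    hence "(\<Sum>i\<in>insert i J. X i) + L = coset (x i) + coset (\<Sum>i\<in>J. x i)"
      using assms(2)[of i] by (simp add: add.assoc)
    also have "\<dots> = coset (\<Sum>i\<in>insert i J. x i)"
      using insert assms(1) by (subst coset_add) (auto intro!: sum_in_model)
    finally show ?case .
  qed (simp_all add: L_eq_coset)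
  from this[of "{i\<in>I. x i \<noteq> 0}"] show ?thesis unfolding quotient_sum_def eq by blast
qed

text \<open>
  The recursion of \<open>word_mode\<close>, with cosets replaced by the polynomials that represent them.
\<close>

primrec pol_word_mode :: "'a heis list \<Rightarrow> int \<Rightarrow> pol \<Rightarrow> pol" where
  "pol_word_mode [] m p = (if m = -1 then p else 0)"
| "pol_word_mode (x # xs) m p =
     (let t = (\<lambda>(n, r). let a = Poly_Mapping.lookup (fst x) n in
          cst (of_int (- r - 1) gchoose nat (- n - 1)) *
            (if r < 0 then letter_op mu (heis_mode a r) (pol_word_mode xs (m + n - r) p)
             else pol_word_mode xs (m + n - r) (letter_op mu (heis_mode a r) p)))
      in \<Sum>i\<in>{i\<in>Poly_Mapping.keys (fst x) \<times> UNIV. t i \<noteq> 0}. t i)"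

lemma word_mode_coset:
  assumes "p \<in> model"
  shows "pol_word_mode xs m p \<in> model \<and> word_mode L xs m (coset p) = coset (pol_word_mode xs m p)"
  using assms
proof (induction xs arbitrary: m p)
  case Nil
  then show ?case by (simp add: zero_in_model L_eq_coset)
next
  case (Cons x xs)
  define t where "t = (\<lambda>(n, r). let a = Poly_Mapping.lookup (fst x) n in
          cst (of_int (- r - 1) gchoose nat (- n - 1)) *
            (if r < 0 then letter_op mu (heis_mode a r) (pol_word_mode xs (m + n - r) p)
             else pol_word_mode xs (m + n - r) (letter_op mu (heis_mode a r) p)))"
  have model: "t nr \<in> model" for nr
    using Cons by (auto simp: t_def Let_def split: prod.split intro!: scale_in_model letter_op_in_model)
  have eq: "pol_word_mode (x # xs) m p = (\<Sum>i\<in>{i\<in>Poly_Mapping.keys (fst x) \<times> UNIV. t i \<noteq> 0}. t i)"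
    by (simp only: pol_word_mode.simps t_def Let_def)
  have "word_mode L (x # xs) m (coset p) = coset (\<Sum>i\<in>{i\<in>Poly_Mapping.keys (fst x) \<times> UNIV. t i \<noteq> 0}. t i)"
    unfolding word_mode.simps
  proof (rule quotient_sum_coset[OF model])
    fix nr :: "int \<times> int"
    obtain n r where nr: "nr = (n, r)" by (cases nr)
    show "(case nr of (n, r) \<Rightarrow> let a = Poly_Mapping.lookup (fst x) n in
          quotient_act L (scal (of_int (- r - 1) gchoose nat (- n - 1)))
            (if r < 0
             then quotient_act L (letter (heis_mode a r)) (word_mode L xs (m + n - r) (coset p))
             else word_mode L xs (m + n - r) (quotient_act L (letter (heis_mode a r)) (coset p)))) = coset (t nr)"
      using Cons by (simp add: nr t_def Let_def quotient_act_coset letter_op_in_model)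
  qed
  moreover have "(\<Sum>i\<in>{i\<in>Poly_Mapping.keys (fst x) \<times> UNIV. t i \<noteq> 0}. t i) \<in> model"
    by (rule sum_in_model) (rule model)
  ultimately show ?case unfolding eq by blast
qed

lemma vertex_mode_coset:
  fixes m :: int and v :: "'a heis free_alg set"
  assumes "p \<in> model"
  defines "q \<equiv> lin_ext (\<lambda>w c. cst c * pol_word_mode (letters w) m p) (negative_representative v)"
  shows "q \<in> model" "vertex_mode L v m (coset p) = coset q"
proof -
  let ?f = "negative_representative v"
  let ?x = "\<lambda>w. cst (Poly_Mapping.lookup ?f w) * pol_word_mode (letters w) m p"
  have model: "?x w \<in> model" for w using word_mode_coset[OF assms(1)] by (simp add: scale_in_model)
  have q: "q = (\<Sum>w\<in>{w\<in>Poly_Mapping.keys ?f. ?x w \<noteq> 0}. ?x w)"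
    unfolding q_def lin_ext_def by (rule sum.mono_neutral_right) auto
  show "q \<in> model" unfolding q by (rule sum_in_model) (rule model)
  show "vertex_mode L v m (coset p) = coset q"
    unfolding vertex_mode_def Let_def q
  proof (rule quotient_sum_coset[OF model])
    fix w
    show "quotient_act L (scal (Poly_Mapping.lookup ?f w)) (word_mode L (letters w) m (coset p)) = coset (?x w)"
      using word_mode_coset[OF assms(1)] by (simp add: quotient_act_coset)
  qed
qed

definition mode_bound :: int where
  "mode_bound = (SOME B. 0 \<le> B \<and> (\<forall>i n. B < int n \<longrightarrow> mu i n = 0))"

lemma mode_bound: "0 \<le> mode_bound \<and> (\<forall>i n. mode_bound < int n \<longrightarrow> mu i n = 0)"
  unfolding mode_bound_def
proof (rule someI_ex)
  have "\<forall>a. \<exists>N. \<forall>n\<ge>N. lam (Poly_Mapping.single n a) = 0"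
    using whittaker by (simp add: whittaker_function_def)
  then obtain N where N: "\<And>a n. n \<ge> N a \<Longrightarrow> lam (Poly_Mapping.single n a) = 0" by metis
  define B where "B = (\<Sum>i<l. N (e i))"
  have B: "mu i n = 0" if "B < n" for i n
  proof (cases "i < l")
    case True
    hence "N (e i) \<le> B" unfolding B_def by (intro member_le_sum) auto
    with that True show ?thesis by (simp add: mu_def N)
  qed (simp add: mu_def)
  thus "\<exists>B. 0 \<le> B \<and> (\<forall>i n. B < int n \<longrightarrow> mu i n = 0)"
    by (intro exI[of _ "int B"]) auto
qed

sublocale truncated_eigenvalues mu mode_bound
  by standard (use mode_bound in auto)

abbreviation fock_image :: "'a heis free_alg \<Rightarrow> pol" where
  "fock_image f \<equiv> act (\<lambda>_ _. 0) f 1"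

text \<open>
  One letter of the recursion, split into basis modes: the sum over pairs \<open>(n, r)\<close> becomes a sum of normally
  ordered products, one for each component \<open>e\<^sub>i(n)\<close> of the letter.
\<close>

lemma pol_field_step:
  assumes neg: "x \<in> heis_neg" and F: "pol_word_mode xs = F" "truncated_field F"
  shows "pol_word_mode (x # xs) m p =
    lin_ext (\<lambda>n a. \<Sum>i<l. cst (form a (e i)) * var_field (i, nat (- n - 1)) F m p) (fst x)"
proof -
  let ?K = "Poly_Mapping.keys (fst x)"
  define c where "c n i = cst (form (Poly_Mapping.lookup (fst x) n) (e i))" for n i
  define s where "s n i = nop_term (binomial_coeff (nat (- n - 1))) i F (m + n) p" for n i
  define t where "t = (\<lambda>(n, r). let a = Poly_Mapping.lookup (fst x) n in
          cst (of_int (- r - 1) gchoose nat (- n - 1)) *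
            (if r < 0 then letter_op mu (heis_mode a r) (pol_word_mode xs (m + n - r) p)
             else pol_word_mode xs (m + n - r) (letter_op mu (heis_mode a r) p)))"
  have F_sum: "F d (sum g I) = (\<Sum>i\<in>I. F d (g i))" for d g and I :: "nat set"
    by (induction I rule: infinite_finite_induct) (simp_all add: truncated_fieldD[OF F(2)])
  have t: "t (n, r) = (\<Sum>i<l. c n i * s n i r)" for n r
    by (simp add: t_def c_def s_def Let_def F(1) letter_op_mode F_sum truncated_fieldD[OF F(2)] nop_term_def
        binomial_coeff_def sum_distrib_left mult.left_commute)
  define R where "R = (\<Union>n\<in>?K. \<Union>i<l. {r. s n i r \<noteq> 0})"
  have R: "finite R" unfolding R_def s_def by (intro finite_UN_I finite_nop_terms[OF F(2)]) auto
  have "pol_word_mode (x # xs) m p = (\<Sum>nr\<in>{nr\<in>?K \<times> UNIV. t nr \<noteq> 0}. t nr)"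
    by (simp only: pol_word_mode.simps t_def Let_def)
  also have "\<dots> = (\<Sum>nr\<in>?K \<times> R. t nr)"
  proof (rule sum.mono_neutral_left)
    show "finite (?K \<times> R)" using R by simp
    show "{nr \<in> ?K \<times> UNIV. t nr \<noteq> 0} \<subseteq> ?K \<times> R"
    proof (intro subrelI)
      fix n r assume "(n, r) \<in> {nr \<in> ?K \<times> UNIV. t nr \<noteq> 0}"
      hence n: "n \<in> ?K" and sum: "(\<Sum>i<l. c n i * s n i r) \<noteq> 0" by (simp_all add: t)
      have "\<exists>i<l. s n i r \<noteq> 0"
      proof (rule ccontr)
        assume "\<not> (\<exists>i<l. s n i r \<noteq> 0)"
        hence "(\<Sum>i<l. c n i * s n i r) = 0" by (intro sum.neutral) auto
        with sum show False by simp
      qed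
      with n show "(n, r) \<in> ?K \<times> R" by (auto simp: R_def)
    qed
  qed auto
  also have "\<dots> = (\<Sum>n\<in>?K. \<Sum>r\<in>R. \<Sum>i<l. c n i * s n i r)"
    by (simp only: sum.cartesian_product' t)
  also have "\<dots> = (\<Sum>n\<in>?K. \<Sum>i<l. c n i * (\<Sum>r\<in>R. s n i r))"
    unfolding sum_distrib_left by (intro sum.cong refl sum.swap)
  also have "\<dots> = lin_ext (\<lambda>n a. \<Sum>i<l. cst (form a (e i)) * var_field (i, nat (- n - 1)) F m p) (fst x)"
    unfolding lin_ext_def
  proof (intro sum.cong refl)
    fix n i assume n: "n \<in> ?K" and i: "i \<in> {..<l}"
    have "n < 0" using neg n by (auto simp: heis_neg_def)
    hence d: "m - int (nat (- n - 1)) - 1 = m + n" by simp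
    have "Sum_any (s n i) = (\<Sum>r\<in>R. s n i r)"
      by (rule Sum_any.expand_superset[OF R]) (use n i in \<open>auto simp: R_def\<close>)
    thus "c n i * (\<Sum>r\<in>R. s n i r) =
        cst (form (Poly_Mapping.lookup (fst x) n) (e i)) * var_field (i, nat (- n - 1)) F m p"
      unfolding c_def s_def var_field_def nop_def fst_conv snd_conv d by simp
  qed
  finally show ?thesis .
qed

text \<open>
  A word enters its vertex operator only through the polynomial that it represents in the Fock space. Hence
  the vertex operator of a vector does not depend on the negative words chosen to express it.
\<close>

lemma pol_word_mode_eq_pol_field:
  assumes "set xs \<subseteq> heis_neg"
  shows "pol_word_mode xs = pol_field (foldr (letter_op (\<lambda>_ _. 0)) xs 1)"
  using assms
proof (induction xs)
  case Nil
  show ?case by (intro ext) (simp add: pol_field_one vacuum_field_def)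
next
  case (Cons x xs)
  let ?P = "foldr (letter_op (\<lambda>_ _. 0)) xs 1"
  from Cons have x: "x \<in> heis_neg" by simp
  have "letter_op (\<lambda>_ _. 0) x ?P =
      lin_ext (\<lambda>n a. \<Sum>i<l. cst (form a (e i)) * (var (i, nat (- n - 1)) * ?P)) (fst x)"
  proof -
    have "snd x = 0" "\<And>n. n \<in> Poly_Mapping.keys (fst x) \<Longrightarrow> n < 0"
      using x by (auto simp: heis_neg_def)
    thus ?thesis by (auto simp: letter_op_def mode_op_def intro!: lin_ext_cong)
  qed
  hence "pol_field (letter_op (\<lambda>_ _. 0) x ?P) m p =
      lin_ext (\<lambda>n a. \<Sum>i<l. cst (form a (e i)) * var_field (i, nat (- n - 1)) (pol_field ?P) m p) (fst x)" for m p
    by (simp add: lin_ext_def pol_field_sum pol_field_cst_mult pol_field_var_mult)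
  with pol_field_step[OF x _ field_pol_field] Cons show ?case by (intro ext) simp
qed

lemma vertex_mode_eq_pol_field:
  assumes "p \<in> model"
    and neg: "\<forall>w\<in>Poly_Mapping.keys (negative_representative v). set (letters w) \<subseteq> heis_neg"
    and P: "fock_image (negative_representative v) = P"
  shows "pol_field P m p \<in> model" "vertex_mode L v m (coset p) = coset (pol_field P m p)"
proof -
  let ?f = "negative_representative v"
  have "lin_ext (\<lambda>w c. cst c * pol_word_mode (letters w) m p) ?f = pol_field P m p"
    unfolding P[symmetric] act_def lin_ext_def pol_field_sum pol_field_cst_mult
    by (intro sum.cong refl) (use neg in \<open>simp add: pol_word_mode_eq_pol_field\<close>)
  with vertex_mode_coset[OF assms(1), where v = v and m = m]
  show "pol_field P m p \<in> model" "vertex_mode L v m (coset p) = coset (pol_field P m p)" by simp_all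
qed

end

section \<open>Power sums are fixed by the symmetric group\<close>

lemma free_map_eq: "free_map h = lin_ext (\<lambda>w c. Poly_Mapping.single (map_fword h w) c)"
  by (simp add: free_map_def lin_ext_def fun_eq_iff)

lemma free_map_simps [simp]:
  "free_map h (f + g) = free_map h f + free_map h g"
  "free_map h (Poly_Mapping.single w c) = Poly_Mapping.single (map_fword h w) c"
  "free_map h 0 = 0"
proof -
  show "free_map h (f + g) = free_map h f + free_map h g"
    unfolding free_map_eq by (rule lin_ext_add) (simp_all add: single_add)
  show "free_map h (Poly_Mapping.single w c) = Poly_Mapping.single (map_fword h w) c"
    unfolding free_map_eq by (rule lin_ext_single) simp
qed (simp add: free_map_eq)

lemma map_fword_add: "map_fword h (u + v) = map_fword h u + map_fword h v"
  by (cases u; cases v) (simp add: plus_fword_def)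

lemma free_map_mult [simp]: "free_map h (f * g) = free_map h f * free_map h g"
proof (induction f rule: poly_mapping_additive_induct)
  case (single w c)
  show ?case
    by (induction g rule: poly_mapping_additive_induct)
      (simp_all add: mult_single map_fword_add distrib_left)
qed (simp_all add: distrib_right)

lemma free_map_letter [simp]: "free_map h (letter x) = letter (h x)"
  by (simp add: letter_def)

lemma free_map_scal [simp]: "free_map h (scal c) = scal c"
  by (simp add: scal_def zero_fword_def)

lemma free_map_one [simp]: "free_map h 1 = 1"
  using free_map_scal[of h 1] by simp

lemma free_map_diff [simp]: "free_map h (f - g) = free_map h f - free_map h g"
  using free_map_simps(1)[of h "f - g" g] by simp

lemma free_map_inverse:
  assumes "\<And>x. h (h' x) = x"
  shows "free_map h (free_map h' f) = f"
proof (induction f rule: poly_mapping_additive_induct)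
  case (single w c)
  show ?case by (cases w) (simp add: assms o_def)
qed simp_all

lemma free_map_sum: "free_map h (sum g I) = (\<Sum>i\<in>I. free_map h (g i))"
  by (induction I rule: infinite_finite_induct) simp_all

context heisenberg
begin

definition isometry :: "('h \<Rightarrow> 'h) \<Rightarrow> bool" where
  "isometry g \<longleftrightarrow> (\<forall>a b. g (a + b) = g a + g b) \<and> (\<forall>c a. g (scl c a) = scl c (g a)) \<and>
     (\<forall>a b. form (g a) (g b) = form a b)"

definition heis_map :: "('h \<Rightarrow> 'h) \<Rightarrow> 'h heis \<Rightarrow> 'h heis" where
  "heis_map g x = (Poly_Mapping.map g (fst x), snd x)"

lemma orthogonal_group_iff: "g \<in> orthogonal_group scl form \<longleftrightarrow> isometry g \<and> bij g"
  by (auto simp: orthogonal_group_def isometry_def Vector_Spaces.linear_iff vector_space_axioms)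

lemma isometry_zero: "isometry g \<Longrightarrow> g 0 = 0"
  by (metis isometry_def scale_zero_left)

lemma isometry_inv:
  assumes "isometry g" "bij g"
  shows "isometry (inv g)"
proof -
  have inv: "g (inv g a) = a" "inv g (g a) = a" for a
    using assms(2) by (simp_all add: bij_is_surj surj_f_inv_f bij_is_inj)
  have "inv g (a + b) = inv g a + inv g b" for a b
  proof -
    have "a + b = g (inv g a + inv g b)" using assms(1) by (simp add: isometry_def inv)
    thus ?thesis by (simp add: inv)
  qed
  moreover have "inv g (scl c a) = scl c (inv g a)" for c a
  proof -
    have "scl c a = g (scl c (inv g a))" using assms(1) by (simp add: isometry_def inv)
    thus ?thesis by (simp add: inv)
  qed
  moreover have "form (inv g a) (inv g b) = form a b" for a b
    using assms(1) by (metis isometry_def inv(1))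
  ultimately show ?thesis by (simp add: isometry_def)
qed

lemma lookup_map: "g 0 = 0 \<Longrightarrow> Poly_Mapping.lookup (Poly_Mapping.map g q) n = g (Poly_Mapping.lookup q n)"
  by (simp add: map.rep_eq when_def)

lemma heis_map_lie_hom:
  assumes g: "isometry g"
  shows "heis_map g (x + y) = heis_map g x + heis_map g y"
    "heis_map g (heis_scale scl c x) = heis_scale scl c (heis_map g x)"
    "heis_map g (heis_bracket form x y) = heis_bracket form (heis_map g x) (heis_map g y)"
proof -
  note z = isometry_zero[OF g]
  show "heis_map g (x + y) = heis_map g x + heis_map g y"
    using g by (auto simp: heis_map_def isometry_def lookup_map z lookup_add plus_prod_def intro!: poly_mapping_eqI)
  show "heis_map g (heis_scale scl c x) = heis_scale scl c (heis_map g x)"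
    using g by (auto simp: heis_map_def heis_scale_def isometry_def lookup_map z intro!: poly_mapping_eqI)
  have "lin_ext (\<lambda>m a. of_int m * form a (Poly_Mapping.lookup (Poly_Mapping.map g (fst y)) (- m)))
      (Poly_Mapping.map g (fst x)) = lin_ext (\<lambda>m a. of_int m * form a (Poly_Mapping.lookup (fst y) (- m))) (fst x)"
    using g by (subst lin_ext_map) (simp_all add: z lookup_map isometry_def)
  thus "heis_map g (heis_bracket form x y) = heis_bracket form (heis_map g x) (heis_map g y)"
    by (simp add: heis_map_def bracket_eq map_eq_zero_iff)
qed

abbreviation fock_ideal where "fock_ideal \<equiv> whittaker_ideal scl form (\<lambda>_. 0)"

lemma fock_whittaker: "whittaker scl form l e (\<lambda>_. 0)"
proof
  have "vector_space (\<lambda>c. Poly_Mapping.map (scl c) :: (nat \<Rightarrow>\<^sub>0 'h) \<Rightarrow> _)"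
    by standard (auto simp: lookup_map lookup_add scale_right_distrib scale_left_distrib intro!: poly_mapping_eqI)
  moreover have "vector_space ((*) :: complex \<Rightarrow> complex \<Rightarrow> complex)"
    by standard (simp_all add: algebra_simps)
  ultimately show "whittaker_function scl (\<lambda>_. 0)"
    by (simp add: whittaker_function_def Vector_Spaces.linear_iff)
qed

lemma fock_mu: "whittaker.mu l e (\<lambda>_. 0) = (\<lambda>_ _. 0)"
  by (simp add: whittaker.mu_def[OF fock_whittaker] fun_eq_iff)

lemma fock_ideal_iff: "f \<in> fock_ideal \<longleftrightarrow> act (\<lambda>_ _. 0) f 1 = 0"
  using whittaker.whittaker_ideal_eq_kernel[OF fock_whittaker] by (simp add: fock_mu)

text \<open>
  An isometry induces an endomorphism of the Heisenberg algebra that preserves the subalgebra of nonnegative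
  modes and its character, hence all generators of the ideal.
\<close>

lemma free_map_fock_ideal:
  assumes g: "isometry g" and f: "f \<in> fock_ideal"
  shows "free_map (heis_map g) f \<in> fock_ideal"
proof -
  interpret fock: whittaker scl form l e "\<lambda>_. 0" by (rule fock_whittaker)
  let ?U = "uea_ideal (heis_scale scl) (heis_bracket form)"
  have "?U \<subseteq> {f. free_map (heis_map g) f \<in> ?U}"
  proof (rule uea_ideal_subset)
    show "two_sided_ideal {f. free_map (heis_map g) f \<in> ?U}"
      using fock.U_two_sided by (auto simp: two_sided_ideal_def left_ideal_def)
  qed (simp_all only: mem_Collect_eq free_map_diff free_map_mult free_map_letter free_map_scal
      heis_map_lie_hom[OF g] fock.U_gens)
  moreover have "free_map (heis_map g) (letter x - scal (whittaker_character (\<lambda>_. 0) x)) \<in> fock_ideal"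
    if "x \<in> heis_nonneg" for x
  proof -
    have "heis_map g x \<in> heis_nonneg"
    proof -
      have "Poly_Mapping.keys (Poly_Mapping.map g (fst x)) \<subseteq> Poly_Mapping.keys (fst x)"
        using isometry_zero[OF g] by (auto simp: in_keys_iff lookup_map)
      with that show ?thesis by (auto simp: heis_nonneg_def heis_map_def)
    qed
    from fock.character_in_L[OF this] show ?thesis
      by (simp add: whittaker_character_def heis_map_def)
  qed
  ultimately have "fock_ideal \<subseteq> {f. free_map (heis_map g) f \<in> fock_ideal}"
    using fock.U_subset_L fock.L_left_ideal
    unfolding whittaker_ideal_def[of scl form "\<lambda>_. 0"] induced_left_ideal_def
    by (intro hull_minimal) (auto simp: left_ideal_def)
  with f show ?thesis by blast
qed

definition power_sum :: "nat list \<Rightarrow> 'h heis free_alg" where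
  "power_sum ks = (\<Sum>i<l. heis_word (map (Pair i) ks))"

lemma free_map_heis_word:
  "free_map (heis_map g) (heis_word vs) =
     prod_list (map (\<lambda>(i, k). letter (heis_mode (g (e i)) (- int k - 1))) vs)" if "g 0 = 0"
proof (induction vs)
  case (Cons v vs)
  have "heis_map g (heis_mode a n) = heis_mode (g a) n" for a n
    using that by (simp add: heis_map_def heis_mode_def)
  with Cons show ?case by (cases v) (simp add: heis_word_def)
qed (simp add: heis_word_def)

lemma free_map_power_sum:
  assumes g: "isometry g" and p: "p permutes {..<l}" "\<And>i. i < l \<Longrightarrow> g (e i) = e (p i)"
  shows "free_map (heis_map g) (power_sum ks) = power_sum ks"
proof -
  have "free_map (heis_map g) (heis_word (map (Pair i) ks)) = heis_word (map (Pair (p i)) ks)" if "i < l" for i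
    unfolding free_map_heis_word[where g = g, OF isometry_zero[OF g]] by (simp add: heis_word_def p(2)[OF that] o_def)
  hence "free_map (heis_map g) (power_sum ks) = (\<Sum>i<l. heis_word (map (Pair (p i)) ks))"
    by (simp add: power_sum_def free_map_sum)
  also have "\<dots> = power_sum ks"
    using sum.permute[OF p(1), of "\<lambda>i. heis_word (map (Pair i) ks)"] by (simp add: power_sum_def o_def)
  finally show ?thesis .
qed

lemma power_sum_fixed:
  "power_sum ks +o fock_ideal \<in> heis_voa_fixed scl form (symmetric_group scl form l e)"
  unfolding heis_voa_fixed_def
proof (intro CollectI conjI ballI)
  let ?v = "power_sum ks +o fock_ideal"
  show "?v \<in> heis_voa scl form"
    unfolding heis_voa_def whittaker_module_def quotient_carrier_def by blast
  have sub: "free_map (heis_map g) f \<in> ?v"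
    if "isometry g" "p permutes {..<l}" "\<And>i. i < l \<Longrightarrow> g (e i) = e (p i)" "f \<in> ?v" for g p f
  proof -
    from that(4) obtain u where u: "u \<in> fock_ideal" "f = power_sum ks + u" by (auto simp: elt_set_plus_def)
    thus ?thesis
      using free_map_fock_ideal[OF that(1) u(1)] free_map_power_sum[OF that(1-3)]
      by (auto simp: elt_set_plus_def)
  qed
  fix g assume "g \<in> symmetric_group scl form l e"
  then obtain p where g: "isometry g" "bij g" and p: "p permutes {..<l}" "\<And>i. i < l \<Longrightarrow> g (e i) = e (p i)"
    by (auto simp: symmetric_group_def orthogonal_group_iff)
  have inv: "isometry (inv g)" using g by (rule isometry_inv)
  have p': "inv p permutes {..<l}" using p(1) by (rule permutes_inv)
  have inv_e: "inv g (e i) = e (inv p i)" if "i < l" for i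
  proof -
    have "inv p i < l" using p' that by (metis lessThan_iff permutes_in_image)
    hence "g (e (inv p i)) = e i" using p by (simp add: permutes_inverses)
    thus ?thesis using g(2) by (metis bij_inv_eq_iff)
  qed
  have h: "heis_map g (heis_map (inv g) x) = x" for x
  proof -
    have "g (inv g a) = a" for a using g(2) by (simp add: bij_is_surj surj_f_inv_f)
    thus ?thesis
      by (auto simp: heis_map_def lookup_map isometry_zero g inv prod_eq_iff intro!: poly_mapping_eqI)
  qed
  have "free_map (heis_map g) ` ?v = ?v"
  proof
    show "free_map (heis_map g) ` ?v \<subseteq> ?v" using sub[OF g(1) p] by blast
    show "?v \<subseteq> free_map (heis_map g) ` ?v"
    proof
      fix f assume "f \<in> ?v"
      hence "free_map (heis_map (inv g)) f \<in> ?v" using sub[OF inv p' inv_e] by blast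
      moreover have "f = free_map (heis_map g) (free_map (heis_map (inv g)) f)"
        by (simp add: free_map_inverse h)
      ultimately show "f \<in> free_map (heis_map g) ` ?v" by blast
    qed
  qed
  thus "voa_act g ?v = ?v" by (simp add: voa_act_def heis_map_def[abs_def])
qed

lemma act_power_sum:
  "act (\<lambda>_ _. 0) (power_sum ks) 1 = (\<Sum>i<l. prod_list (map var (map (Pair i) ks)))"
proof -
  have "act m (sum f I) p = (\<Sum>i\<in>I. act m (f i) p)" for m f p and I :: "nat set"
    by (induction I rule: infinite_finite_induct) simp_all
  moreover have "act (\<lambda>_ _. 0) (heis_word (map (Pair i) ks)) 1 = prod_list (map var (map (Pair i) ks))"
    if "i < l" for i
    using whittaker.act_heis_word[OF fock_whittaker, of "map (Pair i) ks"] that by auto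
  ultimately show ?thesis by (simp add: power_sum_def)
qed

lemma power_sum_letters: "w \<in> Poly_Mapping.keys (power_sum ks) \<Longrightarrow> set (letters w) \<subseteq> heis_neg"
proof -
  assume "w \<in> Poly_Mapping.keys (power_sum ks)"
  hence "w \<in> (\<Union>i<l. Poly_Mapping.keys (heis_word (map (Pair i) ks)))"
    unfolding power_sum_def by (rule subsetD[OF keys_sum])
  then obtain i where w: "w \<in> Poly_Mapping.keys (heis_word (map (Pair i) ks))" by blast
  have "heis_word vs = Poly_Mapping.single (Fword (map (\<lambda>(i, k). heis_mode (e i) (- int k - 1)) vs)) 1" for vs
    unfolding prod_list_letters[symmetric] by (induction vs) (auto simp: heis_word_def)
  with w have "letters w = map (\<lambda>(i, k). heis_mode (e i) (- int k - 1)) (map (Pair i) ks)"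
    by simp
  thus ?thesis by (auto simp: heis_neg_def heis_mode_def split: if_splits)
qed

text \<open>
  The chosen representative is unknown, but every element of the coset represents the same polynomial.
\<close>

lemma negative_representative_power_sum:
  fixes ks :: "nat list"
  defines "f \<equiv> negative_representative (power_sum ks +o fock_ideal)"
  shows "\<forall>w\<in>Poly_Mapping.keys f. set (letters w) \<subseteq> heis_neg"
    "act (\<lambda>_ _. 0) f 1 = (\<Sum>i<l. prod_list (map var (map (Pair i) ks)))"
proof -
  let ?v = "power_sum ks +o fock_ideal"
  have "0 \<in> fock_ideal" by (simp add: fock_ideal_iff)
  hence "power_sum ks \<in> ?v" unfolding elt_set_plus_def by force
  hence "\<exists>f. f \<in> ?v \<and> (\<forall>w\<in>Poly_Mapping.keys f. set (letters w) \<subseteq> heis_neg)"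
    using power_sum_letters by blast
  from someI_ex[OF this] have f: "f \<in> ?v" "\<forall>w\<in>Poly_Mapping.keys f. set (letters w) \<subseteq> heis_neg"
    unfolding f_def negative_representative_def by blast+
  show "\<forall>w\<in>Poly_Mapping.keys f. set (letters w) \<subseteq> heis_neg" by (rule f(2))
  from f(1) obtain u where "u \<in> fock_ideal" "f = power_sum ks + u" by (auto simp: elt_set_plus_def)
  thus "act (\<lambda>_ _. 0) f 1 = (\<Sum>i<l. prod_list (map var (map (Pair i) ks)))"
    by (simp add: act_power_sum fock_ideal_iff)
qed

end

section \<open>Irreducibility\<close>

context whittaker
begin

lemma sum_transpose:
  assumes "i < l" "j < l"
  shows "(\<Sum>k<l. g (Transposition.transpose i j k)) = (\<Sum>k<l. g k)"
  using sum.permute[OF permutes_swap_id[of i "{..<l}" j], of g] assms by (simp add: o_def)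

text \<open>
  If \<open>e\<^sub>i\<close> and \<open>e\<^sub>j\<close> had the same eigenvalues, the isometry that exchanges them would fix \<open>\<lambda>\<close>.
\<close>

lemma eigenvalues_distinct:
  assumes cycles: "\<forall>\<sigma>\<in>two_cycles scl form l e. whittaker_act \<sigma> lam \<noteq> lam"
    and ij: "i < l" "j < l" "i \<noteq> j"
  shows "\<exists>n. mu i n \<noteq> mu j n"
proof (rule ccontr)
  assume "\<nexists>n. mu i n \<noteq> mu j n"
  define \<tau> where "\<tau> = Transposition.transpose i j"
  have \<tau>: "\<tau> permutes {..<l}" unfolding \<tau>_def using ij by (intro permutes_swap_id) auto
  have \<tau>\<tau>: "\<tau> (\<tau> k) = k" for k by (simp add: \<tau>_def)
  have \<tau>l: "\<tau> k < l" if "k < l" for k using permutes_in_image[OF \<tau>, of k] that by simp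
  have mu_\<tau>: "mu (\<tau> k) n = mu k n" for k n
    using \<open>\<nexists>n. mu i n \<noteq> mu j n\<close> by (auto simp: \<tau>_def transpose_def)
  note reindex = sum_transpose[OF ij(1,2), folded \<tau>_def]
  define \<sigma> where "\<sigma> a = (\<Sum>k<l. scl (form a (e k)) (e (\<tau> k)))" for a
  have coord: "form (\<sigma> a) (e k) = form a (e (\<tau> k))" if k: "k < l" for a k
  proof -
    have "form (\<sigma> a) (e k) = (\<Sum>m<l. if m = \<tau> k then form a (e m) else 0)"
      unfolding \<sigma>_def form_sum form_simps
      using k \<tau>l \<tau>\<tau> by (intro sum.cong refl) (auto simp: form_basis)
    with \<tau>l[OF k] show ?thesis by simp
  qed
  have \<sigma>\<sigma>: "\<sigma> (\<sigma> a) = a" for a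
  proof -
    have "\<sigma> (\<sigma> a) = (\<Sum>k<l. scl (form a (e (\<tau> k))) (e (\<tau> k)))"
      unfolding \<sigma>_def[of "\<sigma> a"] by (intro sum.cong refl) (simp add: coord)
    also have "\<dots> = a" using reindex[of "\<lambda>k. scl (form a (e k)) (e k)"] basis_expansion[of a] by simp
    finally show ?thesis .
  qed
  have bij: "bij \<sigma>" by (rule o_bij[of \<sigma>]) (auto simp: \<sigma>\<sigma> fun_eq_iff)
  have inv: "inv \<sigma> = \<sigma>" by (rule inv_equality) (simp_all add: \<sigma>\<sigma>)
  have "isometry \<sigma>"
    unfolding isometry_def
  proof (intro conjI allI)
    show "\<sigma> (a + b) = \<sigma> a + \<sigma> b" for a b
      by (simp add: \<sigma>_def scale_left_distrib sum.distrib)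
    show "\<sigma> (scl c a) = scl c (\<sigma> a)" for c a
      by (simp add: \<sigma>_def scale_sum_right)
    fix a b
    have "form (\<sigma> a) (\<sigma> b) = (\<Sum>k<l. form (\<sigma> a) (e k) * form (\<sigma> b) (e k))"
      by (rule form_expansion)
    also have "\<dots> = (\<Sum>k<l. form a (e (\<tau> k)) * form b (e (\<tau> k)))"
      by (intro sum.cong refl) (simp add: coord)
    also have "\<dots> = (\<Sum>k<l. form a (e k) * form b (e k))"
      by (rule reindex[of "\<lambda>k. form a (e k) * form b (e k)"])
    also have "\<dots> = form a b" by (rule form_expansion[symmetric])
    finally show "form (\<sigma> a) (\<sigma> b) = form a b" .
  qed
  moreover have "\<sigma> (e k) = e (\<tau> k)" if "k < l" for k
  proof -
    have "\<sigma> (e k) = (\<Sum>m<l. if m = k then e (\<tau> m) else 0)"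
      unfolding \<sigma>_def using that by (intro sum.cong refl) (auto simp: form_basis)
    with that show ?thesis by simp
  qed
  ultimately have "\<sigma> \<in> two_cycles scl form l e"
    using ij bij by (auto simp: two_cycles_def orthogonal_group_iff \<tau>_def)
  moreover have "whittaker_act \<sigma> lam = lam"
  proof
    fix x
    have "\<sigma> 0 = 0" by (simp add: \<sigma>_def)
    hence "whittaker_act \<sigma> lam x = lin_ext (\<lambda>n a. \<Sum>k<l. form (\<sigma> a) (e k) * mu k n) x"
      unfolding whittaker_act_def inv by (subst lam_expansion, subst lin_ext_map) simp_all
    also have "(\<lambda>n a. \<Sum>k<l. form (\<sigma> a) (e k) * mu k n) = (\<lambda>n a. \<Sum>k<l. form a (e k) * mu k n)"
    proof (intro ext)
      fix n a
      have "(\<Sum>k<l. form (\<sigma> a) (e k) * mu k n) = (\<Sum>k<l. form a (e (\<tau> k)) * mu (\<tau> k) n)"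
        by (intro sum.cong refl) (simp add: coord mu_\<tau>)
      also have "\<dots> = (\<Sum>k<l. form a (e k) * mu k n)" by (rule reindex)
      finally show "(\<Sum>k<l. form (\<sigma> a) (e k) * mu k n) = (\<Sum>k<l. form a (e k) * mu k n)" .
    qed
    also have "lin_ext (\<lambda>n a. \<Sum>k<l. form a (e k) * mu k n) x = lam x" by (rule lam_expansion[symmetric])
    finally show "whittaker_act \<sigma> lam x = lam x" .
  qed
  ultimately show False using cycles by blast
qed

lemma pol_sum_closed:
  assumes "pol_subspace T"
  shows "(\<And>i. i \<in> I \<Longrightarrow> g i \<in> T) \<Longrightarrow> sum g I \<in> T"
  by (induction I rule: infinite_finite_induct) (auto intro: pol_subspaceD[OF assms])

lemma irreducible:
  assumes cycles: "\<forall>\<sigma>\<in>two_cycles scl form l e. whittaker_act \<sigma> lam \<noteq> lam"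
  shows "whittaker_irreducible scl form lam (heis_voa_fixed scl form (symmetric_group scl form l e))"
  unfolding whittaker_irreducible_def Let_def module_eq
proof (intro conjI allI impI)
  have "coset 1 \<noteq> L" using coset_inj[OF one_in_model, of 0] by (simp add: L_eq_coset)
  with one_in_model show "coset ` model \<noteq> {L}" by blast
next
  fix S
  assume "quotient_subspace L S \<and> (\<forall>v\<in>heis_voa_fixed scl form (symmetric_group scl form l e).
      \<forall>n. \<forall>B\<in>S. vertex_mode L v n B \<in> S)"
  hence S: "quotient_subspace L S" and stable: "\<And>v n B. v \<in> heis_voa_fixed scl form (symmetric_group scl form l e) \<Longrightarrow>
      B \<in> S \<Longrightarrow> vertex_mode L v n B \<in> S" by blast+
  define T where "T = {p\<in>model. coset p \<in> S}"
  have S_eq: "S = coset ` T"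
    using S module_eq by (auto simp: quotient_subspace_def T_def whittaker_module_def)
  have T: "pol_subspace T"
    unfolding pol_subspace_def
  proof (intro conjI ballI allI)
    show "0 \<in> T" using S zero_in_model by (simp add: T_def quotient_subspace_def L_eq_coset)
    show "p + q \<in> T" if "p \<in> T" "q \<in> T" for p q
      using that S by (auto simp: T_def quotient_subspace_def add_in_model simp flip: coset_add)
    show "cst c * p \<in> T" if "p \<in> T" for c p
    proof -
      have "quotient_act L (scal c) (coset p) \<in> S"
        using that S unfolding T_def quotient_subspace_def by blast
      with that show ?thesis by (simp add: T_def quotient_act_coset scale_in_model)
    qed
  qed
  have base: "(\<Sum>i<l. foldr var_field (map (Pair i) ks) vacuum_field m p) \<in> T" if "p \<in> T" for ks m p
  proof -
    let ?P = "\<Sum>i<l. prod_list (map var (map (Pair i) ks))"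
    have "pol_field ?P m p \<in> T"
      using vertex_mode_eq_pol_field[OF _ negative_representative_power_sum, of p ks m]
        stable[OF power_sum_fixed, of "coset p" ks m] that
      by (simp add: T_def)
    thus ?thesis by (simp add: pol_field_sum pol_field_prod_list del: map_map)
  qed
  have modes: "mode_op mu j k p \<in> T" if "j < l" "p \<in> T" for j k p
    using mode_closed[OF T base eigenvalues_distinct[OF cycles] that(2,1)] by blast
  show "S = {L} \<or> S = coset ` model"
  proof (cases "T = {0}")
    case True
    thus ?thesis by (simp add: S_eq L_eq_coset)
  next
    case False
    then obtain p where p: "p \<in> T" "p \<noteq> 0" using pol_subspaceD(1)[OF T] by blast
    have "vars_below l p" using p(1) vars_below_act[OF vars_below_one] by (auto simp: T_def model_def)
    with one_in_invariant_subspace[OF T modes p] have one: "1 \<in> T" by blast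
    have letter: "letter_op mu x q \<in> T" if "q \<in> T" for x q
      unfolding letter_op_def lin_ext_def
      by (intro pol_subspaceD[OF T] pol_sum_closed[OF T] modes that) auto
    have word: "foldr (letter_op mu) xs 1 \<in> T" for xs
      by (induction xs) (simp_all add: one letter)
    have "vacuum_image f \<in> T" for f
      unfolding act_def lin_ext_def by (intro pol_sum_closed[OF T] pol_subspaceD(3)[OF T] word)
    hence "T = model" by (auto simp: model_def T_def)
    thus ?thesis by (simp add: S_eq)
  qed
qed

end

theorem corollary7p2:
  fixes scl :: "complex \<Rightarrow> 'h::ab_group_add \<Rightarrow> 'h"
    and form :: "'h \<Rightarrow> 'h \<Rightarrow> complex"
    and l :: nat
    and e :: "nat \<Rightarrow> 'h"
    and lam :: "(nat \<Rightarrow>\<^sub>0 'h) \<Rightarrow> complex"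
  assumes "l \<ge> 1"
    and "vector_space scl"
    and "nondegenerate_symmetric_form scl form"
    and "orthonormal_basis scl form l e"
    and "whittaker_function scl lam"
    and "\<forall>\<sigma>\<in>two_cycles scl form l e. whittaker_act \<sigma> lam \<noteq> lam"
  shows "whittaker_irreducible scl form lam
           (heis_voa_fixed scl form (symmetric_group scl form l e))"
proof -
  interpret vector_space scl by fact
  interpret whittaker scl form l e lam
    by standard (use assms in auto)
  show ?thesis by (rule irreducible) fact
qed

end
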